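(* Let $d,r\in\mathbb{N}$. There are only finitely many totally real primitive number fields $K$ of degree $d$ that satisfy Condition (A) and over whose ring of integers there exists a universal quadratic form of rank $r$.
   Context: A number field is primitive if it has no subfield other than $\mathbb{Q}$ and itself. A totally real number field $K$ with ring of integers $R$ satisfies Condition (A) if it is monogenic (i.e. $R=\mathbb{Z}[\alpha]$ for some $\alpha\in R$) and $R$ contains units of every signature (for every choice of signs $(s_1,\dots,s_d)\in\{\pm1\}^d$ there is a unit $u$ with $\operatorname{sign}\sigma_i(u)=s_i$ for all real embeddings $\sigma_1,\dots,\sigma_d$). A quadratic form of rank $r$ over $R$ is $Q(v_1,\dots,v_r)=\sum_{1\le i\le j\le r}a_{ij}v_iv_j$ with $a_{ij}\in R$; it is universal if it is totally positive definite ($Q(v)$ is totally positive for all nonzero $v\in R^r$) and represents every totally positive element of $R$ (i.e. for every totally positive $\alpha\in R$ there is $v\in R^r$ with $Q(v)=\alpha$). *)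

theory Defs
  imports "HOL-Algebra.Algebraic_Closure_Type"
begin

text \<open>
  Number fields are taken to be subfields of \<open>\<complex>\<close> of finite degree over \<open>\<rat>\<close>. Every abstract number
  field is isomorphic to one of these, and all the notions below are invariant under isomorphism.
  A field of degree \<open>d\<close> has at most \<open>d\<close> images in \<open>\<complex>\<close>, hence finiteness of a family of subfields
  of bounded degree that is closed under isomorphism agrees with finiteness up to isomorphism.
\<close>

abbreviation complex_ring :: "complex ring"
  where "complex_ring \<equiv> ring_of_type_algebra"

abbreviation real_ring :: "real ring"
  where "real_ring \<equiv> ring_of_type_algebra"

definition number_field :: "complex set \<Rightarrow> bool"
  where "number_field K \<longleftrightarrow> subfield K complex_ring \<and> ring.finite_dimension complex_ring \<rat> K"

definition number_field_degree :: "complex set \<Rightarrow> nat"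
  where "number_field_degree K = ring.dim complex_ring \<rat> K"

definition primitive_field :: "complex set \<Rightarrow> bool"
  where "primitive_field K \<longleftrightarrow> (\<forall>F. subfield F complex_ring \<and> F \<subseteq> K \<longrightarrow> F = \<rat> \<or> F = K)"

text \<open>
  Embeddings are required to be extensional, so that maps which agree on \<open>K\<close> are counted once;
  otherwise prescribing signs embedding by embedding would be contradictory.
\<close>

definition complex_embeddings :: "complex set \<Rightarrow> (complex \<Rightarrow> complex) set"
  where "complex_embeddings K =
    ring_hom (complex_ring\<lparr>carrier := K\<rparr>) complex_ring \<inter> extensional K"

definition real_embeddings :: "complex set \<Rightarrow> (complex \<Rightarrow> real) set"
  where "real_embeddings K =
    ring_hom (complex_ring\<lparr>carrier := K\<rparr>) real_ring \<inter> extensional K"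

definition totally_real :: "complex set \<Rightarrow> bool"
  where "totally_real K \<longleftrightarrow> (\<forall>\<sigma>\<in>complex_embeddings K. \<sigma> ` K \<subseteq> \<real>)"

definition ring_of_integers :: "complex set \<Rightarrow> complex set"
  where "ring_of_integers K = {x \<in> K. algebraic_int x}"

definition totally_positive :: "complex set \<Rightarrow> complex \<Rightarrow> bool"
  where "totally_positive K x \<longleftrightarrow> (\<forall>\<sigma>\<in>real_embeddings K. \<sigma> x > 0)"

definition monogenic :: "complex set \<Rightarrow> bool"
  where "monogenic K \<longleftrightarrow> (\<exists>\<alpha>\<in>ring_of_integers K.
    ring_of_integers K = range (\<lambda>p :: int poly. poly (map_poly of_int p) \<alpha>))"

definition units_of_every_signature :: "complex set \<Rightarrow> bool"
  where "units_of_every_signature K \<longleftrightarrow>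
    (\<forall>s. (\<forall>\<sigma>\<in>real_embeddings K. s \<sigma> \<in> {1, -1}) \<longrightarrow>
      (\<exists>u\<in>Units (complex_ring\<lparr>carrier := ring_of_integers K\<rparr>).
        \<forall>\<sigma>\<in>real_embeddings K. sgn (\<sigma> u) = s \<sigma>))"

definition condition_A :: "complex set \<Rightarrow> bool"
  where "condition_A K \<longleftrightarrow> monogenic K \<and> units_of_every_signature K"

text \<open>
  A quadratic form of rank \<open>r\<close> is given by its coefficients \<open>a i j\<close> for \<open>i \<le> j < r\<close>, and a vector
  by its entries \<open>v i\<close> for \<open>i < r\<close>; values at other indices are irrelevant.
\<close>

definition quadratic_form :: "complex set \<Rightarrow> nat \<Rightarrow> (nat \<Rightarrow> nat \<Rightarrow> complex) \<Rightarrow> bool"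
  where "quadratic_form K r a \<longleftrightarrow> (\<forall>i j. i \<le> j \<and> j < r \<longrightarrow> a i j \<in> ring_of_integers K)"

definition eval_form :: "nat \<Rightarrow> (nat \<Rightarrow> nat \<Rightarrow> complex) \<Rightarrow> (nat \<Rightarrow> complex) \<Rightarrow> complex"
  where "eval_form r a v = (\<Sum>i<r. \<Sum>j=i..<r. a i j * v i * v j)"

definition integral_vectors :: "complex set \<Rightarrow> nat \<Rightarrow> (nat \<Rightarrow> complex) set"
  where "integral_vectors K r = {v. \<forall>i<r. v i \<in> ring_of_integers K}"

definition totally_positive_definite :: "complex set \<Rightarrow> nat \<Rightarrow> (nat \<Rightarrow> nat \<Rightarrow> complex) \<Rightarrow> bool"
  where "totally_positive_definite K r a \<longleftrightarrow>
    (\<forall>v\<in>integral_vectors K r. (\<exists>i<r. v i \<noteq> 0) \<longrightarrow> totally_positive K (eval_form r a v))"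

definition universal_form :: "complex set \<Rightarrow> nat \<Rightarrow> (nat \<Rightarrow> nat \<Rightarrow> complex) \<Rightarrow> bool"
  where "universal_form K r a \<longleftrightarrow>
    totally_positive_definite K r a \<and>
    (\<forall>\<alpha>\<in>ring_of_integers K. totally_positive K \<alpha> \<longrightarrow>
      (\<exists>v\<in>integral_vectors K r. eval_form r a v = \<alpha>))"

end

theory Submission
  imports Defs "HOL-Algebra.Generated_Fields"
begin

text \<open>
  Let \<open>R = \<int>[\<alpha>]\<close>, let \<open>f\<close> be the minimal polynomial of \<open>\<alpha>\<close>, of degree \<open>n\<close>, and let \<open>u\<close> be a unit with
  the signature of \<open>f'(\<alpha>)\<close>. Then \<open>\<delta> = u / f'(\<alpha>)\<close> is a totally positive generator of the codifferent.
  If \<open>z \<noteq> 0\<close> is integral and all conjugates of \<open>\<delta>z\<close> are smaller than \<open>1/J\<close>, then the \<open>J\<close> elements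
  \<open>\<delta>\<^sup>-\<^sup>1 + jz\<close> with \<open>0 \<le> j < J\<close> are totally positive, and \<open>Tr(\<delta>\<cdot>)\<close> is at most \<open>2n\<close> on them. But \<open>Tr(\<delta>Q)\<close> is
  a positive definite integral form of rank \<open>rn\<close>: two vectors of value at most \<open>2n\<close> that are congruent
  modulo \<open>8n + 1\<close> coincide, so \<open>J \<le> (8n + 1)^(rn)\<close>. Hence the codifferent, a lattice under the trace
  form of \<open>K\<close>, has no short nonzero vector. By transference, its dual \<open>R\<close> contains a non-rational \<open>\<theta>\<close>
  whose conjugates are bounded in terms of \<open>n\<close> and \<open>r\<close>. There are finitely many such \<open>\<theta>\<close>, and
  \<open>K = \<rat>(\<theta>)\<close> by primitivity.
\<close>

subsection \<open>Transference\<close>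

lemma additive_of_int_mult:
  fixes l :: "'a::ring_1 \<Rightarrow> 'b::ring_1"
  assumes add: "\<And>x y. l (x + y) = l x + l y"
  shows "l (of_int k * x) = of_int k * l x"
proof -
  interpret additive l by standard (rule add)
  have "l (of_nat m * x) = of_nat m * l x" for m
    by (induction m) (simp_all add: zero add algebra_simps)
  then show ?thesis
    by (cases k rule: int_cases2) (simp_all add: minus)
qed

text \<open>
  Induction on the rank: a functional that is short for the form projected along a nearly shortest
  vector \<open>b\<close> is short for \<open>B\<close>, and the projection loses at most a factor 2 in the minimum. Once the
  projected form vanishes, every \<open>x\<close> is an integer multiple of \<open>b\<close> modulo the radical.
\<close>

lemma short_functional:
  fixes B :: "'a::comm_ring_1 \<Rightarrow> 'a \<Rightarrow> real" and E :: "'a set"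
  assumes "finite E"
    and sym: "\<And>x y. B x y = B y x"
    and add: "\<And>x y z. B (x + y) z = B x z + B y z"
    and psd: "\<And>x. B x x \<ge> 0"
    and "c > 0" and gap: "\<And>x. B x x = 0 \<or> B x x \<ge> c"
    and span: "\<And>x. \<exists>k. \<forall>y. B x y = (\<Sum>e\<in>E. k e * B e y)"
    and nz: "\<exists>x. B x x \<noteq> 0"
  shows "\<exists>l :: 'a \<Rightarrow> int. (\<forall>x y. l (x + y) = l x + l y) \<and> (\<exists>x. l x \<noteq> 0) \<and>
    (\<forall>x. (real_of_int (l x))\<^sup>2 \<le> 2 ^ card E / c * B x x)"
  using assms
proof (induction "card E" arbitrary: E B c)
  case (0 E B c)
  then have "E = {}" by simp
  with "0.prems"(7,8) show ?case by fastforce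
next
  case (Suc m E B c)
  note fin = Suc.prems(1) and sym = Suc.prems(2) and add = Suc.prems(3) and psd = Suc.prems(4)
    and c = Suc.prems(5) and gap = Suc.prems(6) and span = Suc.prems(7) and nz = Suc.prems(8)
  have scale: "B (of_int k * x) y = of_int k * B x y" for k x y
    using additive_of_int_mult[of "\<lambda>x. B x y"] add by simp
  have add': "B z (x + y) = B z x + B z y" and scale': "B y (of_int k * x) = of_int k * B y x" for k x y z
    using add scale sym by metis+
  define S where "S = {B x x | x. B x x \<noteq> 0}"
  have S: "S \<noteq> {}" "\<And>s. s \<in> S \<Longrightarrow> c \<le> s" using nz gap unfolding S_def by blast+
  then have bdd: "bdd_below S" by (meson bdd_belowI)
  have Inf_pos: "Inf S > 0" using cInf_greatest[of S c] S c by force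
  \<comment> \<open>Coming within the factor 5/4 of the infimum suffices: a later loss of 1/4 still
    leaves 4/5 - 1/4 >= 1/2.\<close>
  then have "Inf S < 5/4 * Inf S" by simp
  then obtain b where b: "B b b \<noteq> 0" "B b b < 5/4 * Inf S"
    using cInf_lessD[OF S(1)] unfolding S_def by blast
  have b_min: "4/5 * B b b \<le> B x x" if "B x x \<noteq> 0" for x
  proof -
    have "Inf S \<le> B x x" using that bdd by (intro cInf_lower) (auto simp: S_def)
    then show ?thesis using b by simp
  qed
  have bc: "B b b \<ge> c" using b(1) gap[of b] by simp
  then have b0: "B b b > 0" using c by simp
  define t where "t x = B x b / B b b" for x
  define B' where "B' x y = B x y - B x b * B y b / B b b" for x y
  \<comment> \<open>Completing the square: \<open>B'\<close> is the form projected along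
    \<open>b\<close>, and \<open>t\<close> is the coordinate along \<open>b\<close>, which integer
    multiples of \<open>b\<close> move into [-1/2, 1/2].\<close>
  have shift: "B (of_int N * x + of_int k * b) (of_int N * x + of_int k * b) =
      (of_int N)\<^sup>2 * B' x x + (of_int N * t x + of_int k)\<^sup>2 * B b b" for x N k
  proof -
    have "B (of_int N * x + of_int k * b) (of_int N * x + of_int k * b) =
        (of_int N)\<^sup>2 * B x x + 2 * of_int N * of_int k * B x b + (of_int k)\<^sup>2 * B b b"
      unfolding add add' scale scale' sym[of b x] by (simp add: power2_eq_square algebra_simps)
    moreover have "B x b = t x * B b b" using b(1) by (simp add: t_def)
    ultimately show ?thesis using b(1) unfolding B'_def
      by (simp add: power2_eq_square algebra_simps)
  qed
  have near: "\<exists>k. ((y + of_int k)\<^sup>2 :: real) \<le> 1/4" for y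
  proof -
    have "\<bar>y - of_int (round y)\<bar> \<le> 1/2"
      using of_int_round_abs_le[of y] by (simp add: abs_minus_commute)
    then have "(y + of_int (- round y))\<^sup>2 \<le> (1/2)\<^sup>2"
      by (simp flip: abs_le_square_iff)
    then show ?thesis by (intro exI[of _ "- round y"]) (simp add: power2_eq_square)
  qed
  \<comment> \<open>Cauchy-Schwarz with integer multiples only: for large \<open>N\<close> a
    negative \<open>N^2 * B' x x\<close> would outweigh the at most \<open>B b b / 4\<close> left
    along \<open>b\<close> after rounding.\<close>
  have psd': "B' x x \<ge> 0" for x
  proof (rule ccontr)
    assume neg: "\<not> B' x x \<ge> 0"
    obtain N :: nat where N: "B b b / 4 / (- B' x x) < N" by (meson reals_Archimedean2)
    then have N0: "N > 0" using neg b0 by (cases N) (simp_all add: zero_less_divide_iff)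
    obtain k where k: "(of_int N * t x + of_int k)\<^sup>2 \<le> 1/4" using near by blast
    have "B b b / 4 < N * (- B' x x)" using N neg
      pos_divide_less_eq[of "- B' x x" "B b b / 4" N] by simp
    also have "\<dots> \<le> (real N)\<^sup>2 * (- B' x x)"
      using N0 neg by (intro mult_right_mono) (simp_all add: power2_eq_square)
    finally have "B b b / 4 + (real N)\<^sup>2 * B' x x < 0" by simp
    moreover have "(of_int N * t x + of_int k)\<^sup>2 * B b b \<le> 1/4 * B b b"
      using k b0 by (intro mult_right_mono) auto
    ultimately have "(of_int N)\<^sup>2 * B' x x + (of_int N * t x + of_int k)\<^sup>2 * B b b < 0" by simp
    then show False using psd shift[of "int N" x k] by (metis of_int_of_nat_eq not_less)
  qed
  \<comment> \<open>Reduce \<open>x\<close> modulo \<open>b\<close>. The reduced vector has value 0,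
    and then \<open>B' x x\<close> vanishes too, or at least \<open>4/5 * B b b\<close>, of which at
    most a quarter of \<open>B b b\<close> lies along \<open>b\<close>.\<close>
  have gap'': "B' x x = 0 \<or> B' x x \<ge> B b b / 2" for x
  proof -
    obtain k where k: "(t x + of_int k)\<^sup>2 \<le> 1/4" using near by blast
    have *: "(t x + of_int k)\<^sup>2 * B b b \<le> 1/4 * B b b"
      using k b0 by (intro mult_right_mono) auto
    have **: "(t x + of_int k)\<^sup>2 * B b b \<ge> 0" using b0 by simp
    have ***: "B (x + of_int k * b) (x + of_int k * b) = B' x x + (t x + real_of_int k)\<^sup>2 * B b b"
      using shift[of 1 x k] by simp
    show ?thesis
    proof (cases "B (x + of_int k * b) (x + of_int k * b) = 0")
      case True
      then show ?thesis using *** ** psd'[of x] by linarith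
    next
      case False
      then show ?thesis using b_min[OF False] *** * b0 by linarith
    qed
  qed
  show ?case
  proof (cases "\<forall>x. B' x x = 0")
    case True
    have "\<exists>k::int. t x = of_int k" for x
    proof -
      obtain k where k: "(t x + of_int k)\<^sup>2 \<le> 1/4" using near by blast
      have *: "(t x + of_int k)\<^sup>2 * B b b \<le> 1/4 * B b b"
        using k b0 by (intro mult_right_mono) auto
      have "B (x + of_int k * b) (x + of_int k * b) = (t x + of_int k)\<^sup>2 * B b b"
        using shift[of 1 x k] True by simp
      then have "(t x + of_int k)\<^sup>2 * B b b = 0"
        using * b_min[of "x + of_int k * b"] b0 by fastforce
      then have "t x = of_int (-k)" using b0 by simp
      then show ?thesis by blast
    qed
    then obtain l where l: "\<And>x. t x = of_int (l x)" by metis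
    have "real_of_int (l (x + y)) = of_int (l x + l y)" for x y
      using l[symmetric] by (simp add: t_def add add_divide_distrib)
    moreover have "l b \<noteq> 0" using l[of b] b by (auto simp: t_def)
    moreover have "(real_of_int (l x))\<^sup>2 \<le> 2 ^ card E / c * B x x" for x
    proof -
      have "(real_of_int (l x))\<^sup>2 = B x x / B b b"
      proof -
        have "B x x = B x b * B x b / B b b" using spec[OF True, of x] unfolding B'_def by linarith
        then show ?thesis unfolding l[symmetric] t_def by (simp add: power2_eq_square)
      qed
      also have "\<dots> \<le> B x x / c" using bc c psd by (intro divide_left_mono) auto
      also have "\<dots> \<le> 2 ^ card E * (B x x / c)"
        using psd[of x] c by (intro mult_le_cancel_right1[THEN iffD2]) (auto simp: divide_less_0_iff)
      finally show ?thesis by simp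
    qed
    ultimately show ?thesis by (metis of_int_eq_iff)
  next
    case False
    \<comment> \<open>\<open>b\<close> lies in the radical of \<open>B'\<close>, so a relation
      expressing it by \<open>E\<close> with some nonzero \<open>\<kappa> e0\<close> eliminates
      \<open>e0\<close> and lowers the rank.\<close>
    obtain \<kappa> where \<kappa>: "\<And>y. B b y = (\<Sum>e\<in>E. \<kappa> e * B e y)" using span by blast
    have "\<exists>e0\<in>E. \<kappa> e0 \<noteq> 0"
    proof (rule ccontr)
      assume "\<not> (\<exists>e0\<in>E. \<kappa> e0 \<noteq> 0)"
      then have "(\<Sum>e\<in>E. \<kappa> e * B e b) = 0" by (intro sum.neutral) auto
      then show False using \<kappa>[of b] b(1) by simp
    qed
    then obtain e0 where e0: "e0 \<in> E" "\<kappa> e0 \<noteq> 0" by blast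
    have B'_lin: "B' x y = (\<Sum>e\<in>E. k e * B' e y)" if "\<And>y. B x y = (\<Sum>e\<in>E. k e * B e y)" for x y k
      unfolding B'_def that
      by (simp add: right_diff_distrib sum_subtractf sum_distrib_right sum_divide_distrib mult.assoc)
    have b_rad: "B' b y = 0" for y using b0 sym[of b y] by (simp add: B'_def)
    have e0_lin: "B' e0 y = (\<Sum>e\<in>E - {e0}. - (\<kappa> e / \<kappa> e0) * B' e y)" for y
    proof -
      have "0 = (\<Sum>e\<in>E. \<kappa> e * B' e y)" using B'_lin[OF \<kappa>] b_rad by simp
      also have "\<dots> = \<kappa> e0 * B' e0 y + (\<Sum>e\<in>E - {e0}. \<kappa> e * B' e y)"
        using fin e0 by (simp add: sum.remove)
      finally have "B' e0 y = - (\<Sum>e\<in>E - {e0}. \<kappa> e * B' e y) / \<kappa> e0"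
        using e0(2) by (simp add: field_simps)
      then show ?thesis by (simp add: sum_divide_distrib sum_negf)
    qed
    have span': "\<exists>k. \<forall>y. B' x y = (\<Sum>e\<in>E - {e0}. k e * B' e y)" for x
    proof -
      obtain k where k: "\<And>y. B x y = (\<Sum>e\<in>E. k e * B e y)" using span by blast
      have "B' x y = (\<Sum>e\<in>E - {e0}. (k e - k e0 * (\<kappa> e / \<kappa> e0)) * B' e y)" for y
      proof -
        have "B' x y = k e0 * B' e0 y + (\<Sum>e\<in>E - {e0}. k e * B' e y)"
          using B'_lin[OF k] fin e0 by (simp add: sum.remove)
        then show ?thesis
          by (simp add: e0_lin sum_distrib_left left_diff_distrib sum_subtractf sum_negf mult.assoc)
      qed
      then show ?thesis by (intro exI[of _ "\<lambda>e. k e - k e0 * (\<kappa> e / \<kappa> e0)"] allI)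
    qed
    have "\<exists>l :: 'a \<Rightarrow> int. (\<forall>x y. l (x + y) = l x + l y) \<and> (\<exists>x. l x \<noteq> 0) \<and>
        (\<forall>x. (real_of_int (l x))\<^sup>2 \<le> 2 ^ card (E - {e0}) / (c/2) * B' x x)"
    proof (rule Suc.hyps(1)[where E = "E - {e0}" and B = B' and c = "c/2"])
      show "m = card (E - {e0})" using Suc.hyps(2) e0 fin by simp
      show "B' (x + y) z = B' x z + B' y z" for x y z
        by (simp add: B'_def add field_simps add_divide_distrib)
      show "B' x x = 0 \<or> B' x x \<ge> c/2" for x using gap''[of x] bc by auto
    qed (use fin c sym psd' span' False in \<open>auto simp: B'_def mult.commute\<close>)
    then obtain l :: "'a \<Rightarrow> int" where l: "\<forall>x y. l (x + y) = l x + l y" "\<exists>x. l x \<noteq> 0"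
      "\<And>x. (real_of_int (l x))\<^sup>2 \<le> 2 ^ card (E - {e0}) / (c/2) * B' x x" by blast
    have "(real_of_int (l x))\<^sup>2 \<le> 2 ^ card E / c * B x x" for x
    proof -
      \<comment> \<open>The gap is halved while the rank drops by one, so the constant is
        unchanged.\<close>
      have "2 ^ card (E - {e0}) / (c/2) = 2 ^ card E / c"
        using Suc.hyps(2) e0 fin by (simp flip: Suc.hyps(2))
      moreover have "B' x x \<le> B x x" using b0 by (simp add: B'_def)
      ultimately have "2 ^ card (E - {e0}) / (c/2) * B' x x \<le> 2 ^ card E / c * B x x"
        using c by (intro mult_mono) (auto intro: psd')
      then show ?thesis using l(3)[of x] by linarith
    qed
    then show ?thesis using l(1,2) by blast
  qed
qed

subsection \<open>Evaluation of integer polynomials\<close>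

text \<open>One integer polynomial stands for an element of \<int>[\<alpha>] together with its
  conjugates: it is evaluated at the complex number \<alpha> and at the real roots alike.\<close>

definition ev :: "int poly \<Rightarrow> 'a::comm_ring_1 \<Rightarrow> 'a"
  where "ev p x = poly (map_poly of_int p) x"

lemma ev_0 [simp]: "ev 0 x = 0"
  and ev_1 [simp]: "ev 1 x = 1"
  and ev_pCons [simp]: "ev (pCons c p) x = of_int c + x * ev p x"
  by (simp_all add: ev_def map_poly_pCons)

lemma ev_add [simp]: "ev (p + q) x = ev p x + ev q x"
  by (induction p q rule: poly_induct2) (simp_all add: algebra_simps)

lemma ev_minus [simp]: "ev (- p) x = - ev p x"
  by (induction p) (simp_all add: algebra_simps)

lemma ev_diff [simp]: "ev (p - q) x = ev p x - ev q x"
  using ev_add[of p "-q" x] by simp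

lemma ev_smult [simp]: "ev (smult c p) x = of_int c * ev p x"
  by (induction p) (simp_all add: algebra_simps)

lemma ev_mult [simp]: "ev (p * q) x = ev p x * ev q x"
  by (induction p) (simp_all add: algebra_simps)

lemma ev_power [simp]: "ev (p ^ n) x = ev p x ^ n"
  by (induction n) simp_all

lemma ev_of_nat [simp]: "ev (of_nat n) x = of_nat n"
  by (induction n) simp_all

lemma ev_of_int [simp]: "ev (of_int n) x = of_int n"
  by (cases n rule: int_cases2) simp_all

lemma ev_sum [simp]: "ev (\<Sum>i\<in>I. p i) x = (\<Sum>i\<in>I. ev (p i) x)"
  by (induction I rule: infinite_finite_induct) simp_all

lemma ev_monom [simp]: "ev (monom c n) x = of_int c * x ^ n"
  by (induction n) (simp_all add: monom_0 monom_Suc algebra_simps)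

lemma ev_of_real [simp]: "ev p (of_real a :: 'a::{real_algebra_1,comm_ring_1}) = of_real (ev p a)"
  by (induction p) simp_all

lemma ev_pcompose [simp]: "ev (pcompose p q) x = ev p (ev q x)"
  by (induction p) (simp_all add: pcompose_pCons)

lemma ev_conv_sum: "degree p \<le> n \<Longrightarrow> ev p x = (\<Sum>i\<le>n. of_int (coeff p i) * x ^ i)"
proof (induction p arbitrary: n)
  case (pCons a p)
  show ?case
  proof (cases n)
    case 0
    with pCons.prems have "p = 0" by (auto split: if_splits)
    then show ?thesis using 0 by simp
  next
    case (Suc m)
    with pCons.prems have "degree p \<le> m" by (auto split: if_splits)
    from pCons.IH[OF this] show ?thesis
      unfolding Suc by (subst sum.atMost_Suc_shift) (simp add: sum_distrib_left algebra_simps)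
  qed
qed simp

text \<open>Pseudo-division scales \<open>p\<close> by a power of the leading coefficient of
  \<open>f\<close>, which is 1 here.\<close>

lemma monic_div_mod:
  fixes f p :: "int poly"
  assumes "lead_coeff f = 1"
  shows "\<exists>q r. p = q * f + r \<and> (r = 0 \<or> degree r < degree f)"
proof -
  have "f \<noteq> 0" using assms by auto
  obtain q r where "pseudo_divmod p f = (q, r)" by fastforce
  from pseudo_divmod[OF \<open>f \<noteq> 0\<close> this] show ?thesis
    using assms by (intro exI[of _ q] exI[of _ r]) (simp add: mult.commute)
qed

lemma poly_shift_Suc: "poly_shift (Suc n) (pCons a p) = poly_shift n p"
  by (simp add: poly_eq_iff coeff_poly_shift)

text \<open>Horner's scheme. It shows that dividing an integer polynomial by x - c gives
  coefficients that are integer polynomials in c.\<close>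

lemma coeff_synthetic_div:
  "coeff (synthetic_div p c) j = poly (poly_shift (Suc j) p) c"
proof (induction p arbitrary: j)
  case (pCons a p)
  then show ?case
    by (cases j) (simp_all add: synthetic_div_pCons poly_shift_Suc)
qed simp

lemma ev_poly_shift: "ev (poly_shift j p) x = poly (poly_shift j (map_poly of_int p)) x"
  unfolding ev_def by (intro arg_cong2[of _ _ _ _ poly]) (simp_all add: poly_eq_iff coeff_poly_shift coeff_map_poly)

text \<open>
  An order \<open>\<int>[x]/(f)\<close> with \<open>f\<close> split over \<open>\<real>\<close>: its elements are integer polynomials up to agreement
  on the set \<open>A\<close> of roots of \<open>f\<close>, and \<open>u'\<close> is the inverse of the unit \<open>u\<close>.
\<close>

locale signed_order =
  fixes f u u' :: "int poly" and A :: "real set"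
  assumes monic: "lead_coeff f = 1"
    and finite_A: "finite A"
    and split: "map_poly of_int f = (\<Prod>a\<in>A. [:- a, 1:])"
    and card_A: "card A \<ge> 2"
    and unit: "a \<in> A \<Longrightarrow> ev u a * ev u' a = 1"
    and sign: "a \<in> A \<Longrightarrow> ev u a / ev (pderiv f) a > 0"
begin

definition "f' a = ev (pderiv f) a" for a :: real
definition "\<delta> a = ev u a / f' a" for a
text \<open>\<open>tr\<close> is Euler's functional Tr(p / f'), and \<open>\<phi>\<close> is its
  twist Tr(\<delta> p) by the unit \<open>u\<close>, which has positive weights.\<close>

definition "tr p = (\<Sum>a\<in>A. ev p a / f' a)" for p
definition "\<phi> p = (\<Sum>a\<in>A. \<delta> a * ev p a)" for p

lemma \<phi>_eq: "\<phi> p = tr (u * p)"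
  by (simp add: \<phi>_def tr_def \<delta>_def)

lemma \<delta>_pos: "a \<in> A \<Longrightarrow> \<delta> a > 0"
  using sign by (simp add: \<delta>_def f'_def)

lemma f'_nz: "a \<in> A \<Longrightarrow> f' a \<noteq> 0"
  using \<delta>_pos by (fastforce simp: \<delta>_def)

lemma ev_f: "a \<in> A \<Longrightarrow> ev f a = 0"
  using finite_A by (auto simp: ev_def split poly_prod)

lemma degree_f: "degree f = card A"
proof -
  have "degree (map_poly real_of_int f) = card A"
    unfolding split using finite_A by (subst degree_prod_eq_sum_degree) auto
  then show ?thesis by (simp add: degree_map_poly)
qed

lemma f'_eq: "a \<in> A \<Longrightarrow> f' a = (\<Prod>b\<in>A - {a}. a - b)"
proof -
  assume a: "a \<in> A"
  have "map_poly real_of_int f = [:- a, 1:] * (\<Prod>b\<in>A - {a}. [:- b, 1:])"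
    unfolding split using finite_A a by (rule prod.remove)
  then have "pderiv (map_poly real_of_int f) =
      [:- a, 1:] * pderiv (\<Prod>b\<in>A - {a}. [:- b, 1:]) + (\<Prod>b\<in>A - {a}. [:- b, 1:]) * pderiv [:- a, 1:]"
    by (simp only: pderiv_mult)
  moreover have "map_poly real_of_int (pderiv f) = pderiv (map_poly of_int f)"
    by (simp add: poly_eq_iff coeff_map_poly coeff_pderiv)
  ultimately show ?thesis by (simp add: f'_def ev_def poly_prod pderiv_pCons)
qed

lemma reduce: obtains r where "\<And>a. a \<in> A \<Longrightarrow> ev p a = ev r a" "degree r < card A"
proof -
  obtain q r where "p = q * f + r" "r = 0 \<or> degree r < degree f"
    using monic_div_mod[OF monic] by blast
  then show ?thesis using that[of r] ev_f degree_f card_A by auto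
qed

subsection \<open>The codifferent\<close>

text \<open>Both sides have degree below \<open>card A\<close> and agree on \<open>A\<close>, since
  \<open>f' a\<close> is the value of the cofactor at \<open>a\<close>.\<close>

lemma lagrange:
  assumes "degree p < card A"
  shows "map_poly real_of_int p = (\<Sum>a\<in>A. smult (ev p a / f' a) (\<Prod>b\<in>A - {a}. [:- b, 1:]))"
    (is "_ = ?r")
proof (rule poly_eqI_degree[of A])
  show "poly (map_poly real_of_int p) a = poly ?r a" if a: "a \<in> A" for a
  proof -
    have "poly ?r a = (\<Sum>c\<in>A. ev p c / f' c * (\<Prod>b\<in>A - {c}. a - b))"
      by (simp add: poly_sum poly_prod)
    also have "\<dots> = (\<Sum>c\<in>A. if c = a then ev p a else 0)"
    proof (intro sum.cong refl)
      fix c assume "c \<in> A"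
      then show "ev p c / f' c * (\<Prod>b\<in>A - {c}. a - b) = (if c = a then ev p a else 0)"
        using f'_eq[OF a] f'_nz[OF a] finite_A a by (auto simp: prod_zero_iff)
    qed
    finally show ?thesis using a finite_A by (simp add: ev_def)
  qed
  show "card A > degree (map_poly real_of_int p)" using assms by (simp add: degree_map_poly)
  show "card A > degree ?r"
  proof (rule le_less_trans)
    show "degree ?r \<le> card A - 1"
    proof (intro degree_sum_le finite_A)
      fix a assume "a \<in> A"
      have "degree (smult (ev p a / f' a) (\<Prod>b\<in>A - {a}. [:- b, 1:])) \<le> degree (\<Prod>b\<in>A - {a}. [:- b, 1:])"
        by (rule degree_smult_le)
      also have "\<dots> = card A - 1"
        using finite_A \<open>a \<in> A\<close> by (subst degree_prod_eq_sum_degree) auto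
      finally show "degree (smult (ev p a / f' a) (\<Prod>b\<in>A - {a}. [:- b, 1:])) \<le> card A - 1" .
    qed
  qed (use card_A in simp)
qed

text \<open>Up to the factor \<open>1 / f'\<close>, these form the trace dual of the power basis (Euler).\<close>

definition "dual j = poly_shift (Suc j) f" for j

text \<open>The cofactor is the synthetic quotient of \<open>f\<close> by x - a.\<close>

lemma coeff_cofactor:
  assumes "a \<in> A"
  shows "coeff (\<Prod>b\<in>A - {a}. [:- b, 1:]) j = ev (dual j) a"
proof -
  have "[:- a, 1:] * synthetic_div (map_poly of_int f) a = map_poly real_of_int f"
    using synthetic_div_correct'[of a "map_poly of_int f"] ev_f[OF assms] by (simp add: ev_def)
  also have "\<dots> = [:- a, 1:] * (\<Prod>b\<in>A - {a}. [:- b, 1:])"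
    unfolding split using finite_A assms by (rule prod.remove)
  finally have "synthetic_div (map_poly of_int f) a = (\<Prod>b\<in>A - {a}. [:- b, 1:])"
    by (subst (asm) mult_cancel_left) auto
  then show ?thesis by (metis coeff_synthetic_div ev_poly_shift dual_def)
qed

text \<open>Compare the coefficients of x^j in Lagrange's formula.\<close>

lemma tr_dual:
  assumes "degree p < card A"
  shows "tr (dual j * p) = coeff p j"
proof -
  have "of_int (coeff p j) = coeff (map_poly real_of_int p) j" by (simp add: coeff_map_poly)
  also have "\<dots> = (\<Sum>a\<in>A. ev p a / f' a * ev (dual j) a)"
    by (subst lagrange[OF assms]) (simp add: coeff_sum coeff_cofactor)
  finally show ?thesis by (simp add: tr_def mult.commute)
qed

lemma tr_lead:
  assumes "degree p < card A"
  shows "tr p = coeff p (card A - 1)"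
proof -
  \<comment> \<open>Shifting \<open>f\<close> by its full degree leaves only the leading coefficient
    1.\<close>
  have "dual (card A - 1) = 1"
    using card_A degree_f monic
    by (auto simp: poly_eq_iff dual_def coeff_poly_shift coeff_1 intro!: coeff_eq_0)
  then show ?thesis using tr_dual[OF assms, of "card A - 1"] by simp
qed

text \<open>Modulo \<open>f\<close> the sum becomes one integer coefficient of the remainder; so 1 /
  f' lies in the codifferent.\<close>

lemma tr_int: "tr p \<in> \<int>"
proof -
  obtain r where "\<And>a. a \<in> A \<Longrightarrow> ev p a = ev r a" "degree r < card A" using reduce[of p] by blast
  then have "tr p = tr r" by (simp add: tr_def)
  also have "tr r = coeff r (card A - 1)" by (rule tr_lead) fact
  finally show ?thesis by simp
qed

lemma \<phi>_int: "\<phi> p \<in> \<int>"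
  by (simp add: \<phi>_eq tr_int)

text \<open>A preimage of 1 under \<open>\<phi>\<close>: \<open>u'\<close> cancels the unit in
  \<delta>, and what remains is Euler's functional at x^(n-1).\<close>

definition "w = monom 1 (card A - 1) * u'"

lemma \<phi>_w: "\<phi> w = 1"
proof -
  have "\<phi> w = tr (monom 1 (card A - 1))"
    unfolding \<phi>_def tr_def
    by (intro sum.cong refl) (use unit in \<open>simp add: w_def \<delta>_def field_simps\<close>)
  also have "\<dots> = 1" using card_A by (subst tr_lead) (auto simp: degree_monom_eq)
  finally show ?thesis .
qed

lemma \<phi>_add: "\<phi> (p + q) = \<phi> p + \<phi> q"
  by (simp add: \<phi>_def sum.distrib algebra_simps)

lemma \<phi>_cong: "(\<And>a. a \<in> A \<Longrightarrow> ev p a = ev q a) \<Longrightarrow> \<phi> p = \<phi> q"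
  by (simp add: \<phi>_def)

text \<open>The pairing \<phi>(g p) is unimodular: the powers of x have the dual basis
  \<open>u' * dual j\<close>, so \<open>l\<close> has its values on the powers as coordinates. By
  \<open>vanish\<close> it factors through \<int>[x]/(f).\<close>

lemma functional_repr:
  fixes l :: "int poly \<Rightarrow> int"
  assumes add: "\<And>p q. l (p + q) = l p + l q"
    and vanish: "\<And>p. (\<And>a. a \<in> A \<Longrightarrow> ev p a = 0) \<Longrightarrow> l p = 0"
  shows "\<exists>g. \<forall>p. real_of_int (l p) = (\<Sum>a\<in>A. \<delta> a * ev g a * ev p a)"
proof -
  define n where "n = card A"
  define g where "g = (\<Sum>j<n. of_int (l (monom 1 j)) * dual j)"
  interpret l: additive l by standard (rule add)
  have scale: "l (of_int k * p) = k * l p" for k p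
    using additive_of_int_mult[of l, OF add] by simp
  have "real_of_int (l p) = (\<Sum>a\<in>A. \<delta> a * ev (u' * g) a * ev p a)" for p
  proof -
    obtain r where r: "\<And>a. a \<in> A \<Longrightarrow> ev p a = ev r a" "degree r < card A" by (rule reduce[of p]) blast
    have "(\<Sum>a\<in>A. \<delta> a * ev (u' * g) a * ev p a) = (\<Sum>a\<in>A. ev g a * ev r a / f' a)"
      using unit r by (intro sum.cong refl) (simp add: \<delta>_def field_simps)
    also have "\<dots> = (\<Sum>a\<in>A. \<Sum>j<n. of_int (l (monom 1 j)) * (ev (dual j * r) a / f' a))"
      by (simp add: g_def sum_distrib_right sum_divide_distrib mult.assoc)
    also have "\<dots> = (\<Sum>j<n. of_int (l (monom 1 j)) * tr (dual j * r))"
      by (subst sum.swap) (simp add: tr_def sum_distrib_left)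
    also have "\<dots> = of_int (\<Sum>j<n. coeff r j * l (monom 1 j))"
      using tr_dual[OF r(2)] by (simp add: mult.commute)
    also have "(\<Sum>j<n. coeff r j * l (monom 1 j)) = l (\<Sum>j<n. of_int (coeff r j) * monom 1 j)"
      by (simp only: l.sum scale)
    also have "(\<Sum>j<n. of_int (coeff r j) * monom 1 j) = (\<Sum>j\<le>degree r. monom (coeff r j) j)"
      using r(2)
      by (intro sum.mono_neutral_cong_right) (auto simp: n_def of_int_poly smult_monom not_le coeff_eq_0)
    also have "\<dots> = r" by (simp add: poly_as_sum_of_monoms)
    also have "l r = l p" using vanish[of "r - p"] l.diff[of r p] r by simp
    finally show ?thesis by simp
  qed
  then show ?thesis by blast
qed

text \<open>The nonnegative integers \<open>\<phi> (y ^ (2 * m))\<close> tend to \<open>0\<close>, so one of them is \<open>0\<close>.\<close>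

lemma eq_0_if_small:
  assumes small: "\<And>a. a \<in> A \<Longrightarrow> \<bar>ev y a\<bar> < 1" and "a \<in> A"
  shows "ev y a = 0"
proof -
  have lim: "(\<lambda>m. \<phi> (y ^ (2 * m))) \<longlonglongrightarrow> (\<Sum>a\<in>A. \<delta> a * 0)"
    unfolding \<phi>_def ev_power power_mult
    by (intro tendsto_intros LIMSEQ_power_zero)
       (use small in \<open>simp add: abs_square_less_1\<close>)
  then have "eventually (\<lambda>m. \<bar>\<phi> (y ^ (2 * m))\<bar> < 1) sequentially"
    using tendstoD[OF lim, of 1] by (simp add: dist_real_def)
  then obtain m where m: "\<bar>\<phi> (y ^ (2 * m))\<bar> < 1" by (auto simp: eventually_sequentially)
  have "\<phi> (y ^ (2 * m)) = 0" using m \<phi>_int[of "y ^ (2 * m)"] by (elim Ints_cases) simp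
  then have "\<delta> a * ev y a ^ (2 * m) = 0"
    unfolding \<phi>_def ev_power using finite_A \<open>a \<in> A\<close> \<delta>_pos
    by (subst (asm) sum_nonneg_eq_0_iff) (auto simp: power_mult intro!: mult_nonneg_nonneg intro: less_imp_le)
  then show ?thesis using \<delta>_pos[OF \<open>a \<in> A\<close>] by simp
qed

section \<open>Universality against short codifferent vectors\<close>

lemma obtain_reduction:
  obtains rd where "\<And>p a. a \<in> A \<Longrightarrow> ev (rd p) a = ev p a" "\<And>p. degree (rd p) < card A"
proof -
  have "\<forall>p. \<exists>r. (\<forall>a\<in>A. ev r a = ev p a) \<and> degree r < card A"
    using reduce by metis
  then show ?thesis using that by metis
qed

text \<open>\<open>J\<close> exceeds by one the number of residue classes modulo
  \<open>8 * card A + 1\<close> of vectors of length \<open>r\<close>, each entry reduced to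
  \<open>card A\<close> coefficients; so two of \<open>J\<close> represented elements have congruent
  vectors.\<close>

lemma codifferent_gap:
  fixes Q :: "nat \<Rightarrow> nat \<Rightarrow> int poly" and r :: nat
  defines "form \<equiv> \<lambda>v. \<Sum>i<r. \<Sum>j=i..<r. Q i j * v i * v j"
  defines "J \<equiv> (8 * card A + 1) ^ (card A * r) + 1"
  assumes posdef: "\<And>v i a b. i < r \<Longrightarrow> b \<in> A \<Longrightarrow> ev (v i) b \<noteq> 0 \<Longrightarrow> a \<in> A \<Longrightarrow> ev (form v) a > 0"
    and univ: "\<And>p. (\<And>a. a \<in> A \<Longrightarrow> ev p a > 0) \<Longrightarrow> \<exists>v. \<forall>a\<in>A. ev (form v) a = ev p a"
    and a0: "a0 \<in> A" "ev z a0 \<noteq> 0"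
  shows "\<exists>a\<in>A. \<delta> a * \<bar>ev z a\<bar> \<ge> 1 / real J"
proof (rule ccontr)
  assume "\<not> ?thesis"
  then have small: "\<delta> a * \<bar>ev z a\<bar> < 1 / real J" if "a \<in> A" for a
    using that by (auto simp: not_le)
  define n where "n = card A"
  define M where "M = 8 * n + 1"
  \<comment> \<open>\<open>pderiv f * u'\<close> takes the values 1 / \<delta> on \<open>A\<close>,
    so \<delta> times \<open>g j\<close> is 1 + j \<delta> z, strictly between 0 and 2 for
    \<open>j < J\<close>.\<close>
  define g where "g j = pderiv f * u' + of_nat j * z" for j :: nat
  have "J > 0" by (simp add: J_def)
  then have J: "real J > 0" by simp
  have g: "0 < ev (g j) a" "\<delta> a * ev (g j) a \<le> 2" if "j < J" "a \<in> A" for j a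
  proof -
    have "\<delta> a * ev (pderiv f * u') a = 1"
      using unit[OF that(2)] f'_nz[OF that(2)] by (simp add: \<delta>_def f'_def mult.commute)
    then have eq: "\<delta> a * ev (g j) a = 1 + real j * (\<delta> a * ev z a)"
      by (simp add: g_def algebra_simps)
    have "\<bar>real j * (\<delta> a * ev z a)\<bar> = real j * (\<delta> a * \<bar>ev z a\<bar>)"
      using \<delta>_pos[OF that(2)] by (simp add: abs_mult)
    also have "\<dots> \<le> real j * (1 / real J)" using small[OF that(2)] by (intro mult_left_mono) auto
    also have "\<dots> < 1" using that(1) by simp
    finally have "\<bar>real j * (\<delta> a * ev z a)\<bar> < 1" .
    then have "0 < \<delta> a * ev (g j) a" "\<delta> a * ev (g j) a \<le> 2" unfolding eq by linarith+
    then show "0 < ev (g j) a" "\<delta> a * ev (g j) a \<le> 2"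
      using \<delta>_pos[OF that(2)] by (simp_all add: zero_less_mult_iff)
  qed
  have "\<forall>j. \<exists>v. j < J \<longrightarrow> (\<forall>a\<in>A. ev (form v) a = ev (g j) a)"
    using univ g(1) by metis
  then obtain v where v: "\<And>j a. j < J \<Longrightarrow> a \<in> A \<Longrightarrow> ev (form (v j)) a = ev (g j) a" by metis
  obtain rd where rd: "\<And>p a. a \<in> A \<Longrightarrow> ev (rd p) a = ev p a" "\<And>p. degree (rd p) < card A"
    by (rule obtain_reduction) blast
  define \<kappa> where "\<kappa> j = (\<lambda>(i, m)\<in>{..<r} \<times> {..<n}. coeff (rd (v j i)) m mod int M)" for j
  have "\<kappa> ` {..<J} \<subseteq> {..<r} \<times> {..<n} \<rightarrow>\<^sub>E {0..<int M}"
    by (auto simp: \<kappa>_def M_def split: if_splits)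
  then have "card (\<kappa> ` {..<J}) \<le> card ({..<r} \<times> {..<n} \<rightarrow>\<^sub>E {0..<int M})"
    by (intro card_mono finite_PiE) auto
  also have "\<dots> = M ^ (n * r)" by (simp add: card_PiE card_cartesian_product mult.commute)
  also have "\<dots> < card {..<J}" by (simp add: J_def M_def n_def)
  finally have "\<not> inj_on \<kappa> {..<J}" by (rule pigeonhole)
  then obtain j j' where j: "j < J" "j' < J" "j \<noteq> j'" "\<kappa> j = \<kappa> j'" by (auto simp: inj_on_def)
  have "\<exists>w. rd (v j i) - rd (v j' i) = smult (int M) w" if "i < r" for i
  proof -
    have "int M dvd coeff (rd (v j i) - rd (v j' i)) m" for m
    proof (cases "m < n")
      case True
      with \<open>i < r\<close> have "coeff (rd (v j i)) m mod int M = coeff (rd (v j' i)) m mod int M"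
        using fun_cong[OF j(4), of "(i, m)"] by (simp add: \<kappa>_def)
      then show ?thesis by (simp add: mod_eq_dvd_iff)
    next
      case False
      then show ?thesis
        using rd(2)[of "v j i"] rd(2)[of "v j' i"] by (simp add: n_def coeff_eq_0)
    qed
    then have "[:int M:] dvd rd (v j i) - rd (v j' i)" by (simp add: const_poly_dvd_iff)
    then show ?thesis by (auto elim!: dvdE)
  qed
  then obtain w where w: "\<And>i. i < r \<Longrightarrow> rd (v j i) - rd (v j' i) = smult (int M) (w i)" by metis
  have w': "ev (v j i) a - ev (v j' i) a = real M * ev (w i) a" if "i < r" "a \<in> A" for i a
    using arg_cong[OF w[OF that(1)], of "\<lambda>p. ev p a"] rd(1)[OF that(2)] by simp
  define q where "q a x = (\<Sum>i<r. \<Sum>j=i..<r. ev (Q i j) a * x i * x j)" for a :: real and x :: "nat \<Rightarrow> real"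
  have form_q: "ev (form x) a = q a (\<lambda>i. ev (x i) a)" for x a
    by (simp add: form_def q_def)
  have q_cong: "q a x = q a y" if "\<And>i. i < r \<Longrightarrow> x i = y i" for a x y
    unfolding q_def using that by (intro sum.cong refl) auto
  have q_scale: "q a (\<lambda>i. s * x i) = s\<^sup>2 * q a x" for a s x
    by (simp add: q_def sum_distrib_left power2_eq_square mult_ac)
  \<comment> \<open>With nonnegativity, this bounds the form at a difference by twice the sum of the
    two values.\<close>
  have parallelogram: "q a (\<lambda>i. x i - y i) + q a (\<lambda>i. x i + y i) = 2 * q a x + 2 * q a y" for a x y
    by (simp add: q_def sum_distrib_left flip: sum.distrib) (simp add: algebra_simps)
  have form_nonneg: "ev (form x) a \<ge> 0" if "a \<in> A" for x a
  proof (cases "\<exists>i<r. ev (x i) a \<noteq> 0")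
    case True
    then show ?thesis using posdef that by (meson less_imp_le)
  next
    case False
    then show ?thesis by (simp add: form_q q_def)
  qed
  have form_w: "(real M)\<^sup>2 * ev (form w) a = q a (\<lambda>i. ev (v j i) a - ev (v j' i) a)" if "a \<in> A" for a
    unfolding form_q q_scale[symmetric] using w' that by (intro q_cong) simp
  \<comment> \<open>Otherwise \<open>g j\<close> and \<open>g j'\<close> would agree at
    \<open>a0\<close>, against \<open>j \<noteq> j'\<close> and
    \<open>ev z a0 \<noteq> 0\<close>.\<close>
  have "\<exists>i<r. ev (w i) a0 \<noteq> 0"
  proof (rule ccontr)
    assume *: "\<not> ?thesis"
    then have "ev (form (v j)) a0 = ev (form (v j')) a0"
      unfolding form_q using w'[OF _ a0(1)] by (intro q_cong) fastforce
    then have "ev (g j) a0 = ev (g j') a0" using v j a0 by simp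
    then show False using j(3) a0(2) by (simp add: g_def)
  qed
  then have w_pos: "ev (form w) a > 0" if "a \<in> A" for a using posdef a0(1) that by blast
  \<comment> \<open>The 8 is 2 * 2 + 2 * 2, from the bound 2 on \<delta> times \<open>g j\<close>
    and \<open>g j'\<close>.\<close>
  have bound: "(real M)\<^sup>2 * (\<delta> a * ev (form w) a) \<le> 8" if "a \<in> A" for a
  proof -
    have "(real M)\<^sup>2 * ev (form w) a \<le> 2 * ev (g j) a + 2 * ev (g j') a"
      using form_w[OF that] parallelogram[of a "\<lambda>i. ev (v j i) a" "\<lambda>i. ev (v j' i) a"]
        form_nonneg[OF that, of "\<lambda>i. v j i + v j' i"] v[OF _ that] j
      by (simp add: form_q)
    then have "\<delta> a * ((real M)\<^sup>2 * ev (form w) a) \<le> \<delta> a * (2 * ev (g j) a + 2 * ev (g j') a)"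
      using \<delta>_pos[OF that] by (intro mult_left_mono) auto
    also have "\<dots> \<le> 8" using g(2)[OF j(1) that] g(2)[OF j(2) that] by (simp add: algebra_simps)
    finally show ?thesis by (simp add: mult_ac)
  qed
  \<comment> \<open>\<open>\<phi> (form w)\<close> is a positive integer, so that M^2 <= 8 n < M,
    which is absurd.\<close>
  have "\<phi> (form w) > 0" unfolding \<phi>_def using finite_A a0 w_pos \<delta>_pos by (intro sum_pos) auto
  then have "\<phi> (form w) \<ge> 1" using \<phi>_int[of "form w"] by (elim Ints_cases) simp
  then have "(real M)\<^sup>2 \<le> (real M)\<^sup>2 * \<phi> (form w)" by (simp add: mult_le_cancel_left1)
  also have "\<dots> \<le> (\<Sum>a\<in>A. 8)" unfolding \<phi>_def sum_distrib_left by (intro sum_mono bound)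
  also have "\<dots> < real M" by (simp add: M_def n_def)
  also have "\<dots> \<le> (real M)\<^sup>2" by (simp add: M_def power2_eq_square)
  finally show False by simp
qed

text \<open>
  Transference is applied to the kernel of \<open>\<phi>\<close>, on which multiplication by \<open>\<delta>\<close> yields the elements of
  the codifferent of trace \<open>0\<close>; the projection \<open>pr\<close> onto it is along \<open>w\<close>. With \<open>l = \<phi> (g \<cdot>)\<close>, the bound
  on \<open>l\<close> is tested at the single element \<open>z = \<delta>\<^sup>-\<^sup>1\<theta>\<close>, where \<open>\<theta> = n g - Tr g\<close>.
\<close>

lemma bounded_nonconstant:
  fixes J :: real
  assumes "J > 0"
    and gap: "\<And>z a. a \<in> A \<Longrightarrow> ev z a \<noteq> 0 \<Longrightarrow> \<exists>a\<in>A. \<delta> a * \<bar>ev z a\<bar> \<ge> 1 / J"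
  shows "\<exists>\<theta>. (\<Sum>a\<in>A. (ev \<theta> a)\<^sup>2) \<le> (real (card A))\<^sup>2 * 2 ^ card A * J\<^sup>2 \<and> (\<exists>a\<in>A. \<exists>b\<in>A. ev \<theta> a \<noteq> ev \<theta> b)"
proof -
  define n where "n = card A"
  define pr where "pr p a = ev p a - \<phi> p * ev w a" for p a
  define B where "B p q = (\<Sum>a\<in>A. (\<delta> a)\<^sup>2 * pr p a * pr q a)" for p q
  define E where "E = monom (1::int) ` {..<n}"
  have card_E: "card E = n" unfolding E_def
    by (subst card_image) (auto simp: inj_on_def monom_eq_iff')
  have pr_0: "pr p a = 0" if "B p p = 0" "a \<in> A" for p a
    using that \<delta>_pos finite_A unfolding B_def
    by (subst (asm) sum_nonneg_eq_0_iff) (force simp: mult.assoc)+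
  have "\<exists>l :: int poly \<Rightarrow> int. (\<forall>x y. l (x + y) = l x + l y) \<and> (\<exists>x. l x \<noteq> 0) \<and>
    (\<forall>x. (real_of_int (l x))\<^sup>2 \<le> 2 ^ card E / (1 / J\<^sup>2) * B x x)"
  proof (rule short_functional[where B = B and E = E])
    show "B (p + q) s = B p s + B q s" for p q s
      by (simp add: B_def pr_def \<phi>_add algebra_simps flip: sum.distrib)
    show "B p p \<ge> 0" for p
      unfolding B_def by (intro sum_nonneg) (simp add: mult.assoc)
    show "B p p = 0 \<or> B p p \<ge> 1 / J\<^sup>2" for p
    proof (cases "\<forall>a\<in>A. pr p a = 0")
      case False
      \<comment> \<open>As \<open>\<phi> p\<close> is an integer, the projection is again an integer
        polynomial, and the gap applies to it.\<close>
      obtain k where k: "\<phi> p = of_int k" using \<phi>_int by (meson Ints_cases)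
      have pr: "pr p a = ev (p - of_int k * w) a" for a by (simp add: pr_def k)
      from False obtain a where a: "a \<in> A" "1 / J \<le> \<delta> a * \<bar>pr p a\<bar>"
        using gap unfolding pr by blast
      have "(1 / J)\<^sup>2 \<le> (\<delta> a * \<bar>pr p a\<bar>)\<^sup>2" using a \<open>J > 0\<close> by (intro power_mono) auto
      also have "\<dots> = (\<delta> a)\<^sup>2 * pr p a * pr p a" by (simp add: power_mult_distrib power2_eq_square)
      also have "\<dots> \<le> B p p" unfolding B_def
        using a finite_A by (intro member_le_sum) (auto simp: mult.assoc)
      finally show ?thesis by (simp add: power_one_over)
    qed (simp add: B_def)
    show "\<exists>k. \<forall>y. B p y = (\<Sum>e\<in>E. k e * B e y)" for p
    proof -
      obtain r where r: "\<And>a. a \<in> A \<Longrightarrow> ev p a = ev r a" "degree r < card A" by (rule reduce[of p]) blast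
      have *: "ev r a = (\<Sum>i<n. of_int (coeff r i) * a ^ i)" for a :: real
        using ev_conv_sum[of r "n - 1" a] r(2) card_A
        by (simp add: n_def lessThan_Suc_atMost [symmetric] del: lessThan_Suc)
      have "\<phi> p = \<phi> r" by (rule \<phi>_cong) (rule r)
      also have "\<dots> = (\<Sum>i<n. of_int (coeff r i) * \<phi> (monom 1 i))"
        unfolding \<phi>_def * by (simp add: sum_distrib_left sum.swap[of _ A] mult_ac)
      finally have \<phi>_p: "\<phi> p = (\<Sum>i<n. of_int (coeff r i) * \<phi> (monom 1 i))" .
      have pr_p: "pr p a = (\<Sum>i<n. of_int (coeff r i) * pr (monom 1 i) a)" if "a \<in> A" for a
        unfolding pr_def r(1)[OF that] * \<phi>_p
        by (simp add: right_diff_distrib sum_subtractf sum_distrib_right mult.assoc)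
      have "B p y = (\<Sum>i<n. of_int (coeff r i) * B (monom 1 i) y)" for y
        unfolding B_def sum_distrib_left
        by (subst sum.swap) (intro sum.cong refl, simp add: pr_p sum_distrib_left sum_distrib_right mult_ac)
      also have "\<dots> y = (\<Sum>e\<in>E. of_int (coeff r (degree e)) * B e y)" for y
        unfolding E_def
        by (subst sum.reindex) (auto simp: inj_on_def monom_eq_iff' degree_monom_eq)
      finally show ?thesis by (intro exI[of _ "\<lambda>e. of_int (coeff r (degree e))"] allI)
    qed
    show "\<exists>p. B p p \<noteq> 0"
    proof (rule ccontr)
      assume "\<not> ?thesis"
      then have *: "ev p a = \<phi> p * ev w a" if "a \<in> A" for p a
        using pr_0[of p a] that by (simp add: pr_def)
      \<comment> \<open>All evaluations being proportional to that of \<open>w\<close>, comparing x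
        with 1 leaves at most one point in \<open>A\<close>.\<close>
      have "a = \<phi> (monom 1 1) / \<phi> 1" if "a \<in> A" for a
      proof -
        have "1 = \<phi> 1 * ev w a" "a = \<phi> (monom 1 1) * ev w a"
          using *[OF that, of 1] *[OF that, of "monom 1 1"] by simp_all
        then show ?thesis by (metis mult.commute mult.right_neutral nonzero_mult_div_cancel_left
              mult.left_commute mult_zero_left zero_neq_one)
      qed
      then have "card A \<le> card {\<phi> (monom 1 1) / \<phi> 1}" by (intro card_mono) auto
      then show False using card_A by simp
    qed
  qed (use \<open>J > 0\<close> in \<open>auto simp: E_def B_def mult_ac\<close>)
  then obtain l :: "int poly \<Rightarrow> int" where l_add: "\<And>x y. l (x + y) = l x + l y"
    and l_nz: "\<exists>x. l x \<noteq> 0" and l_le: "\<And>x. (real_of_int (l x))\<^sup>2 \<le> 2 ^ n * J\<^sup>2 * B x x"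
    unfolding card_E by auto
  have l_0: "l p = 0" if "\<And>a. a \<in> A \<Longrightarrow> pr p a = 0" for p
    using l_le[of p] that by (simp add: B_def)
  \<comment> \<open>\<open>l\<close> vanishes wherever \<open>B\<close> does, so it depends only on
    the values on \<open>A\<close>.\<close>
  obtain g where g: "\<And>p. real_of_int (l p) = (\<Sum>a\<in>A. \<delta> a * ev g a * ev p a)"
  proof -
    have "l p = 0" if "\<And>a. a \<in> A \<Longrightarrow> ev p a = 0" for p
      using l_0[of p] that by (simp add: pr_def \<phi>_def)
    then show ?thesis using functional_repr[of l, OF l_add] that by blast
  qed
  \<comment> \<open>The factor \<open>pderiv f\<close> cancels the denominators in
    \<open>tr\<close>, which shows the trace of \<open>g\<close> to be an integer.\<close>
  obtain T where T: "tr (g * pderiv f) = of_int T" using tr_int by (meson Ints_cases)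
  have T': "(\<Sum>a\<in>A. ev g a) = of_int T"
    unfolding T[symmetric] tr_def using f'_nz by (intro sum.cong refl) (simp add: f'_def)
  define \<theta> where "\<theta> = of_nat n * g - of_int T"
  define S where "S = (\<Sum>a\<in>A. (ev \<theta> a)\<^sup>2)"
  have sum_\<theta>: "(\<Sum>a\<in>A. ev \<theta> a) = 0"
    by (simp add: \<theta>_def sum_subtractf sum_distrib_left[symmetric] T' n_def)
  have S_eq: "S = n * (\<Sum>a\<in>A. ev g a * ev \<theta> a)"
  proof -
    have "S = (\<Sum>a\<in>A. n * (ev g a * ev \<theta> a) - of_int T * ev \<theta> a)"
      unfolding S_def power2_eq_square by (simp add: \<theta>_def algebra_simps)
    then show ?thesis by (simp add: sum_subtractf sum_distrib_left[symmetric] sum_\<theta>)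
  qed
  define z where "z = pderiv f * u' * \<theta>"
  have \<delta>_z: "\<delta> a * ev z a = ev \<theta> a" if "a \<in> A" for a
    using unit[OF that] f'_nz[OF that] by (simp add: z_def \<delta>_def f'_def mult_ac)
  have "\<phi> z = 0" using \<delta>_z sum_\<theta> by (simp add: \<phi>_def)
  then have pr_z: "pr z a = ev z a" for a by (simp add: pr_def)
  have B_z: "B z z = S" unfolding B_def S_def pr_z
    by (intro sum.cong refl) (simp add: \<delta>_z[symmetric] power2_eq_square mult_ac)
  have l_z: "real_of_int (l z) = (\<Sum>a\<in>A. ev g a * ev \<theta> a)"
    unfolding g by (intro sum.cong refl) (simp add: \<delta>_z[symmetric] mult_ac)
  \<comment> \<open>\<open>S\<close> is n times \<open>l z\<close>, and also \<open>B z z\<close>;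
    hence the bound on \<open>l\<close> at \<open>z\<close> has one factor \<open>S\<close> to
    cancel.\<close>
  have "S\<^sup>2 = (real n)\<^sup>2 * (real_of_int (l z))\<^sup>2" unfolding S_eq l_z by (simp add: power_mult_distrib)
  also have "\<dots> \<le> (real n)\<^sup>2 * (2 ^ n * J\<^sup>2 * S)"
    using l_le[of z] unfolding B_z by (intro mult_left_mono) auto
  finally have "S * S \<le> ((real n)\<^sup>2 * 2 ^ n * J\<^sup>2) * S" by (simp add: power2_eq_square mult_ac)
  moreover have "S \<ge> 0" unfolding S_def by (intro sum_nonneg) simp
  ultimately have S_le: "S \<le> (real n)\<^sup>2 * 2 ^ n * J\<^sup>2"
    by (cases "S = 0") (auto simp: mult_le_cancel_right)
  have "\<exists>a\<in>A. \<exists>b\<in>A. ev \<theta> a \<noteq> ev \<theta> b"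
  proof (rule ccontr)
    assume *: "\<not> ?thesis"
    have "ev \<theta> a = 0" if "a \<in> A" for a
    proof -
      have "(\<Sum>b\<in>A. ev \<theta> b) = (\<Sum>b\<in>A. ev \<theta> a)" using * that by (intro sum.cong refl) blast
      then show ?thesis using sum_\<theta> card_A by simp
    qed
    then have ng: "real n * ev g a = of_int T" if "a \<in> A" for a using that by (simp add: \<theta>_def)
    \<comment> \<open>When \<theta> vanishes on \<open>A\<close>, \<open>l\<close> is T/n times
      \<phi>; but \<open>l w = 0\<close> and \<open>\<phi> w = 1\<close>, so \<open>l\<close> would
      be zero.\<close>
    have nl: "real n * of_int (l p) = of_int T * \<phi> p" for p
      unfolding g \<phi>_def sum_distrib_left by (intro sum.cong refl) (simp add: ng[symmetric] mult_ac)
    have "l w = 0" by (rule l_0) (simp add: pr_def \<phi>_w)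
    then have "T = 0" using nl[of w] by (simp add: \<phi>_w)
    then show False using nl l_nz card_A by (auto simp: n_def)
  qed
  then show ?thesis using S_le unfolding S_def n_def by blast
qed

text \<open>
  Siegel's pigeonhole argument, which makes characteristic polynomials unnecessary: by
  \<open>eq_0_if_small\<close>, it suffices to make all \<open>h (\<theta> a)\<close> smaller than \<open>1\<close>.
\<close>

lemma bounded_relation:
  fixes b :: nat
  defines "H \<equiv> (3 * ((card A + 1) * b ^ card A)) ^ card A + 1"
  assumes "b \<ge> 1" and \<theta>: "\<And>a. a \<in> A \<Longrightarrow> \<bar>ev \<theta> a\<bar> \<le> real b"
  shows "\<exists>h. h \<noteq> 0 \<and> degree h \<le> card A \<and> (\<forall>i. \<bar>coeff h i\<bar> \<le> int H) \<and> (\<forall>a\<in>A. ev h (ev \<theta> a) = 0)"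
proof -
  define n where "n = card A"
  \<comment> \<open>\<open>H * D\<close> bounds the values of polynomials with coefficients below
    \<open>H\<close>. As H > (3 D)^n, there are fewer tuples of floors than the H^(n+1) coefficient
    vectors.\<close>
  define D where "D = (n + 1) * b ^ n"
  define C where "C = {..n} \<rightarrow>\<^sub>E {..<H}"
  define hp where "hp c = (\<Sum>i\<le>n. monom (int (c i)) i)" for c :: "nat \<Rightarrow> nat"
  define \<kappa> where "\<kappa> c = (\<lambda>a\<in>A. \<lfloor>ev (hp c) (ev \<theta> a)\<rfloor>)" for c
  have H: "H \<ge> 1" by (simp add: H_def)
  have "b ^ n > 0" using \<open>b \<ge> 1\<close> by simp
  then have D: "D \<ge> 1" unfolding D_def by (metis Suc_eq_plus1 mult_pos_pos zero_less_Suc Suc_leI One_nat_def)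
  have "\<bar>ev (hp c) (ev \<theta> a)\<bar> \<le> real (H * D)" if "c \<in> C" "a \<in> A" for c a
  proof -
    have "\<bar>ev (hp c) (ev \<theta> a)\<bar> \<le> (\<Sum>i\<le>n. \<bar>real (c i) * ev \<theta> a ^ i\<bar>)"
      by (simp add: hp_def sum_abs)
    also have "\<dots> \<le> (\<Sum>i\<le>n. real H * real b ^ n)"
    proof (rule sum_mono)
      fix i assume i: "i \<in> {..n}"
      have "\<bar>ev \<theta> a\<bar> ^ i \<le> real b ^ i" using \<theta>[OF that(2)] by (intro power_mono) auto
      also have "\<dots> \<le> real b ^ n" using i \<open>b \<ge> 1\<close> by (intro power_increasing) auto
      finally have "\<bar>ev \<theta> a\<bar> ^ i \<le> real b ^ n" .
      moreover have "c i < H" using that(1) i by (auto simp: C_def)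
      ultimately show "\<bar>real (c i) * ev \<theta> a ^ i\<bar> \<le> real H * real b ^ n"
        unfolding abs_mult power_abs by (intro mult_mono) auto
    qed
    also have "\<dots> = real (H * D)" by (simp add: D_def algebra_simps)
    finally show ?thesis .
  qed
  then have "\<kappa> ` C \<subseteq> A \<rightarrow>\<^sub>E {- int (H * D)..int (H * D)}"
    by (fastforce simp: \<kappa>_def abs_le_iff le_floor_iff floor_le_iff)
  then have "card (\<kappa> ` C) \<le> card (A \<rightarrow>\<^sub>E {- int (H * D)..int (H * D)})"
    by (intro card_mono finite_PiE finite_A) auto
  also have "\<dots> = (2 * (H * D) + 1) ^ n"
    using finite_A by (simp add: card_PiE n_def nat_add_distrib nat_mult_distrib mult.commute)
  also have "\<dots> \<le> (3 * (H * D)) ^ n" using H D by (intro power_mono) auto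
  also have "\<dots> = (3 * D) ^ n * H ^ n" by (simp add: power_mult_distrib mult_ac)
  also have "\<dots> < H * H ^ n" using H by (intro mult_strict_right_mono) (auto simp: H_def D_def n_def)
  also have "\<dots> = card C" by (simp add: C_def card_PiE)
  finally have "\<not> inj_on \<kappa> C" by (rule pigeonhole)
  then obtain c c' where c: "c \<in> C" "c' \<in> C" "c \<noteq> c'" "\<kappa> c = \<kappa> c'" by (auto simp: inj_on_def)
  define h where "h = hp c - hp c'"
  have coeff_h: "coeff h i = (if i \<le> n then int (c i) - int (c' i) else 0)" for i
    by (simp add: h_def hp_def coeff_sum)
  have "h \<noteq> 0"
  proof
    assume "h = 0"
    then have "c i = c' i" if "i \<le> n" for i using coeff_h[of i] that by simp
    then show False using c by (auto simp: C_def intro: PiE_ext)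
  qed
  moreover have "degree h \<le> n" by (rule degree_le) (simp add: coeff_h)
  moreover have "\<bar>coeff h i\<bar> \<le> int H" for i
  proof (cases "i \<le> n")
    case True
    then have "c i < H" "c' i < H" using c by (auto simp: C_def)
    then show ?thesis unfolding coeff_h by (simp add: abs_le_iff)
  qed (simp add: coeff_h)
  moreover have "ev h (ev \<theta> a) = 0" if "a \<in> A" for a
  proof -
    \<comment> \<open>Equal floors put the two values less than 1 apart.\<close>
    have "\<bar>ev (pcompose h \<theta>) a\<bar> < 1" if "a \<in> A" for a
    proof -
      have "\<lfloor>ev (hp c) (ev \<theta> a)\<rfloor> = \<lfloor>ev (hp c') (ev \<theta> a)\<rfloor>"
        using fun_cong[OF c(4), of a] that by (simp add: \<kappa>_def)
      then show ?thesis by (simp add: h_def) linarith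
    qed
    then show ?thesis using eq_0_if_small[of "pcompose h \<theta>" a] that by simp
  qed
  ultimately show ?thesis unfolding n_def by blast
qed

end

subsection \<open>Minimal integer polynomials\<close>

text \<open>If c is the leading coefficient and n the degree, c^(n-1) g(x) is a monic integer
  polynomial in c x.\<close>

lemma scaled_root_algebraic_int:
  fixes x :: "'a::field_char_0"
  assumes "g \<noteq> 0" "ev g x = 0"
  shows "algebraic_int (of_int (lead_coeff g) * x)"
proof -
  define n where "n = degree g"
  define c where "c = lead_coeff g"
  have "n > 0"
  proof (rule ccontr)
    assume "\<not> n > 0"
    then obtain k where "g = [:k:]" unfolding n_def by (metis degree_eq_zeroE gr0I)
    then show False using assms by simp
  qed
  define m where "m = (\<Sum>i<n. monom (coeff g i * c ^ (n - 1 - i)) i) + monom 1 n"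
  have coeff_m: "coeff m i = (if i < n then coeff g i * c ^ (n - 1 - i) else if i = n then 1 else 0)" for i
    by (simp add: m_def coeff_sum)
  have "degree m = n" by (intro antisym degree_le le_degree) (simp_all add: coeff_m)
  then have "lead_coeff m = 1" by (simp add: coeff_m)
  moreover have "ev m (of_int c * x) = 0"
  proof -
    have "ev m (of_int c * x) = (\<Sum>i<n. of_int (coeff g i * c ^ (n - 1 - i)) * (of_int c * x) ^ i) + (of_int c * x) ^ n"
      by (simp add: m_def)
    also have "(\<Sum>i<n. of_int (coeff g i * c ^ (n - 1 - i)) * (of_int c * x) ^ i) =
        (\<Sum>i<n. of_int c ^ (n - 1) * (of_int (coeff g i) * x ^ i))"
    proof (intro sum.cong refl)
      fix i assume "i \<in> {..<n}"
      then have "n - 1 = (n - 1 - i) + i" by simp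
      then have "(of_int c :: 'a) ^ (n - 1) = of_int c ^ (n - 1 - i) * of_int c ^ i" by (metis power_add)
      then show "of_int (coeff g i * c ^ (n - 1 - i)) * (of_int c * x) ^ i =
          of_int c ^ (n - 1) * (of_int (coeff g i) * x ^ i)"
        by (simp add: power_mult_distrib mult_ac)
    qed
    also have "(of_int c * x) ^ n = of_int c ^ (n - 1) * (of_int (coeff g n) * x ^ n)"
      using \<open>n > 0\<close> by (cases n) (simp_all add: power_mult_distrib c_def n_def)
    also have "(\<Sum>i<n. of_int c ^ (n - 1) * (of_int (coeff g i) * x ^ i)) + of_int c ^ (n - 1) * (of_int (coeff g n) * x ^ n)
        = of_int c ^ (n - 1) * ev g x"
      by (subst ev_conv_sum[of g n])
         (simp_all add: n_def sum_distrib_left distrib_left flip: lessThan_Suc_atMost)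
    finally show ?thesis by (simp add: assms)
  qed
  ultimately show ?thesis unfolding algebraic_int_altdef_ipoly c_def ev_def by blast
qed

text \<open>Divisibility is meant in \<int>[x], which builds Gauss's lemma into the notion.\<close>

definition minimal_int_poly :: "int poly \<Rightarrow> 'a::comm_ring_1 \<Rightarrow> bool"
  where "minimal_int_poly f x \<longleftrightarrow> lead_coeff f = 1 \<and> ev f x = 0 \<and> (\<forall>h. ev h x = 0 \<longrightarrow> f dvd h)"

lemma minimal_int_polyD:
  assumes "minimal_int_poly f x"
  shows "lead_coeff f = 1" "ev f x = 0" "ev h x = 0 \<Longrightarrow> f dvd h"
  using assms by (auto simp: minimal_int_poly_def)

lemma ev_dvd: "f dvd h \<Longrightarrow> ev f x = 0 \<Longrightarrow> ev h x = 0"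
  by (auto elim!: dvdE)

text \<open>Up to sign, the primitive part of an integer relation of least degree has the
  property.\<close>

lemma minimal_int_poly_exists:
  fixes x :: "'a::field_char_0"
  assumes "algebraic_int x"
  shows "\<exists>f. minimal_int_poly f x"
proof -
  obtain m where m: "ev m x = 0" "lead_coeff m = 1"
    using assms unfolding algebraic_int_altdef_ipoly ev_def by blast
  have "\<exists>g. (g \<noteq> 0 \<and> ev g x = 0) \<and> (\<forall>h. h \<noteq> 0 \<and> ev h x = 0 \<longrightarrow> degree g \<le> degree h)"
    by (rule ex_has_least_nat[of _ m]) (use m in auto)
  then obtain g where g: "g \<noteq> 0" "ev g x = 0" and least: "\<And>h. h \<noteq> 0 \<Longrightarrow> ev h x = 0 \<Longrightarrow> degree g \<le> degree h"
    by blast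
  define f where "f = primitive_part g"
  have "ev (smult (content g) f) x = 0" unfolding f_def content_times_primitive_part by (rule g)
  then have f: "f \<noteq> 0" "ev f x = 0" "degree f = degree g" "content f = 1"
    using g(1) by (simp_all add: f_def del: content_times_primitive_part)
  have dvd: "f dvd h" if "ev h x = 0" for h
  proof -
    obtain q r where qr: "pseudo_divmod h f = (q, r)" by fastforce
    define c where "c = lead_coeff f ^ (Suc (degree h) - degree f)"
    have eq: "smult c h = f * q + r" and r: "r = 0 \<or> degree r < degree f"
      using pseudo_divmod[OF f(1) qr] by (simp_all add: c_def)
    have "c \<noteq> 0" using f(1) by (simp add: c_def)
    have "ev r x = 0" using arg_cong[OF eq, of "\<lambda>p. ev p x"] that f by simp
    then have "r = 0" using r least[of r] f(3) by force
    then have hq: "smult c h = f * q" using eq by simp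
    \<comment> \<open>Gauss's lemma: \<open>f\<close> has content 1, so the constant
      \<open>c\<close> divides \<open>q\<close> and cancels.\<close>
    then have "content q = content (smult c h)" using f by (simp add: content_mult)
    then have "[:c:] dvd q" by (simp add: const_poly_dvd_iff_dvd_content)
    then obtain q' where "q = smult c q'" by (auto elim!: dvdE)
    then have "smult c h = smult c (f * q')" using hq by simp
    then have "h = f * q'" using \<open>c \<noteq> 0\<close> by (simp add: poly_eq_iff)
    then show ?thesis by simp
  qed
  define s where "s = lead_coeff f"
  obtain k where "m = f * k" using dvd[OF m(1)] by (elim dvdE)
  \<comment> \<open>\<open>f\<close> divides the monic \<open>m\<close>, so its leading coefficient
    is 1 or -1.\<close>
  then have "s * lead_coeff k = 1" using m(2) by (simp add: s_def lead_coeff_mult)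
  then have s: "s * s = 1" by (auto simp: zmult_eq_1_iff)
  have "minimal_int_poly (smult s f) x"
    unfolding minimal_int_poly_def
  proof (intro conjI allI impI)
    show "lead_coeff (smult s f) = 1" using s by (simp only: lead_coeff_smult flip: s_def)
    show "ev (smult s f) x = 0" using f by simp
    show "smult s f dvd h" if "ev h x = 0" for h
    proof -
      obtain k where "h = f * k" using dvd[OF \<open>ev h x = 0\<close>] by (elim dvdE)
      then have "h = smult s f * smult s k" using s by simp
      then show ?thesis by (metis dvd_triv_left)
    qed
  qed
  then show ?thesis by blast
qed

text \<open>Irreducibility: the minimal polynomial \<open>h\<close> of \<open>y\<close> divides
  \<open>f\<close>. Were \<open>x\<close> a root of the other factor, \<open>h\<close> would divide
  1, although it vanishes at \<open>y\<close>.\<close>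

lemma minimal_int_poly_conjugate:
  fixes x :: "'a::field_char_0" and y :: "'b::field_char_0"
  assumes f: "minimal_int_poly f x" and y: "ev f y = 0"
  shows "minimal_int_poly f y"
proof -
  note fD = minimal_int_polyD[OF f]
  have "algebraic_int y" using y fD(1) unfolding algebraic_int_altdef_ipoly ev_def by blast
  then obtain h where h: "minimal_int_poly h y" using minimal_int_poly_exists by blast
  note hD = minimal_int_polyD[OF h]
  obtain k where k: "f = h * k" using hD(3)[OF y] by (elim dvdE)
  have "f dvd h"
  proof (rule ccontr)
    assume "\<not> f dvd h"
    then have "ev h x \<noteq> 0" using fD(3) by blast
    then have "ev k x = 0" using fD(2) unfolding k by simp
    then have "f dvd k" by (rule fD(3))
    then obtain k' where "k = f * k'" by (elim dvdE)
    then have "f * (h * k') = f * 1" using k by (simp add: mult_ac)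
    then have "h * k' = 1" using fD(1) by (subst (asm) mult_cancel_left) auto
    then have "ev (h * k') y = 1" by simp
    then show False using hD(2) by simp
  qed
  then show ?thesis using fD(1) y hD(3) unfolding minimal_int_poly_def by (blast intro: dvd_trans)
qed

text \<open>In characteristic 0, \<open>f\<close> cannot divide its derivative, which is nonzero and
  of smaller degree.\<close>

lemma minimal_int_poly_pderiv:
  fixes x :: "'a::field_char_0"
  assumes "minimal_int_poly f x"
  shows "ev (pderiv f) x \<noteq> 0"
proof
  note fD = minimal_int_polyD[OF assms]
  assume "ev (pderiv f) x = 0"
  then have dvd: "f dvd pderiv f" by (rule fD(3))
  have "degree f \<noteq> 0"
  proof
    assume "degree f = 0"
    then obtain c where "f = [:c:]" by (rule degree_eq_zeroE)
    then show False using fD(1,2) by simp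
  qed
  then have "pderiv f \<noteq> 0" "degree (pderiv f) < degree f" by (simp_all add: pderiv_eq_0_iff degree_pderiv)
  then show False using dvd_imp_degree_le[OF dvd] by simp
qed

text \<open>\<open>f\<close> is squarefree and splits over the complex numbers, which gives its
  degree; over the reals, degree, leading coefficient and values on \<open>A\<close> then determine
  it.\<close>

lemma minimal_int_poly_split_real:
  fixes x :: complex and f :: "int poly"
  defines "A \<equiv> {a :: real. ev f a = 0}"
  assumes f: "minimal_int_poly f x" and real: "\<And>s :: complex. ev f s = 0 \<Longrightarrow> s \<in> \<real>"
  shows "finite A" "degree f = card A" "map_poly of_int f = (\<Prod>a\<in>A. [:- a, 1:])"
    "x \<in> of_real ` A"
proof -
  note fD = minimal_int_polyD[OF f]
  have roots: "{z. poly (map_poly of_int f) z = 0} = (of_real ` A :: complex set)"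
    using real by (fastforce simp: A_def ev_def[symmetric] elim!: Reals_cases)
  show "x \<in> of_real ` A" using fD(2) unfolding roots[symmetric] by (simp add: ev_def)
  have "f \<noteq> 0" using fD(1) by auto
  then have "map_poly of_int f \<noteq> (0 :: real poly)" by (subst map_poly_eq_0_iff) auto
  then have fin: "finite {a. poly (map_poly of_int f) a = (0::real)}" by (rule poly_roots_finite)
  then show "finite A" by (simp add: A_def ev_def)
  have pderiv: "pderiv (map_poly of_int f) = (map_poly of_int (pderiv f) :: complex poly)"
    by (simp add: poly_eq_iff coeff_map_poly coeff_pderiv)
  have "rsquarefree (map_poly of_int f :: complex poly)"
    unfolding rsquarefree_roots pderiv ev_def[symmetric]
    using minimal_int_poly_pderiv minimal_int_poly_conjugate[OF f] by blast
  then have "smult (lead_coeff (map_poly of_int f)) (\<Prod>z\<in>of_real ` A. [:- z, 1:]) = (map_poly of_int f :: complex poly)"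
    unfolding roots[symmetric] by (rule complex_poly_decompose_rsquarefree)
  then have "map_poly of_int f = (\<Prod>a\<in>A. [:- of_real a, 1 :: complex:])"
    using fD(1) by (simp add: coeff_map_poly degree_map_poly prod.reindex inj_on_def)
  then have "degree (map_poly of_int f :: complex poly) = card A"
    using \<open>finite A\<close> by (simp add: degree_prod_sum_eq)
  then show deg: "degree f = card A" by (simp add: degree_map_poly)
  have degP: "degree (\<Prod>a\<in>A. [:- a, 1:]) = card A" using \<open>finite A\<close> by (simp add: degree_prod_sum_eq)
  show "map_poly of_int f = (\<Prod>a\<in>A. [:- a, 1:])"
  proof (rule poly_eqI_degree_lead_coeff[where n = "card A" and A = A])
    have "lead_coeff (\<Prod>a\<in>A. [:- a, 1:]) = 1" by (simp add: lead_coeff_prod)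
    then show "coeff (map_poly of_int f) (card A) = coeff (\<Prod>a\<in>A. [:- a, 1:]) (card A)"
      using fD(1) unfolding degP deg by (simp add: coeff_map_poly)
    show "poly (map_poly of_int f) z = poly (\<Prod>a\<in>A. [:- a, 1:]) z" if "z \<in> A" for z
      using that \<open>finite A\<close> by (auto simp: poly_prod A_def ev_def prod_zero_iff)
  qed (simp_all add: degP degree_map_poly deg)
qed

subsection \<open>Number fields inside \<open>\<complex>\<close>\<close>

lemma ring_of_type_algebra_simps [simp]:
  "carrier ring_of_type_algebra = UNIV"
  "x \<otimes>\<^bsub>ring_of_type_algebra\<^esub> y = x * y"
  "x \<oplus>\<^bsub>ring_of_type_algebra\<^esub> y = x + y"
  "\<one>\<^bsub>ring_of_type_algebra\<^esub> = 1"
  "\<zero>\<^bsub>ring_of_type_algebra\<^esub> = 0"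
  by (simp_all add: ring_of_type_algebra_def)

lemma a_inv_ring_of_type_algebra [simp]:
  fixes x :: "'a::comm_ring_1"
  shows "\<ominus>\<^bsub>ring_of_type_algebra\<^esub> x = - x"
proof -
  interpret cring "ring_of_type_algebra :: 'a ring" by (rule cring_from_type_algebra)
  show ?thesis using sum_zero_eq_neg[of "- x" x] by simp
qed

lemma m_inv_ring_of_type_algebra:
  fixes x :: "'a::field"
  assumes "x \<noteq> 0"
  shows "inv\<^bsub>ring_of_type_algebra\<^esub> x = inverse x"
proof -
  interpret cring "ring_of_type_algebra :: 'a ring" by (rule cring_from_type_algebra)
  show ?thesis using comm_inv_char[of x "inverse x"] assms by simp
qed

lemma subfield_Rats: "subfield \<rat> complex_ring"
proof -
  interpret field complex_ring by (rule field_from_type_algebra)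
  show ?thesis
    by (intro subfieldI' subringI) (auto simp: m_inv_ring_of_type_algebra)
qed

lemma subfield_closed:
  assumes "subfield K complex_ring"
  shows "1 \<in> K" "x \<in> K \<Longrightarrow> y \<in> K \<Longrightarrow> x + y \<in> K" "x \<in> K \<Longrightarrow> y \<in> K \<Longrightarrow> x * y \<in> K"
    "0 \<in> K" "x \<in> K \<Longrightarrow> - x \<in> K"
  using subringE[OF subfieldE(1)[OF assms]] by simp_all

lemma subfield_of_int:
  assumes "subfield K complex_ring"
  shows "of_int c \<in> K"
proof -
  have "of_nat n \<in> K" for n by (induction n) (auto intro: subfield_closed[OF assms])
  then show ?thesis by (cases c rule: int_cases2) (auto intro: subfield_closed(5)[OF assms])
qed

lemma subfield_ev:
  assumes "subfield K complex_ring" "x \<in> K"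
  shows "ev p x \<in> K"
  by (induction p) (use assms in \<open>auto intro!: subfield_closed subfield_of_int\<close>)

section \<open>Integer relations in a number field\<close>

lemma clear_denominators:
  fixes q :: "'a::field_char_0 poly"
  assumes "\<And>i. coeff q i \<in> \<rat>"
  shows "\<exists>c g. c \<noteq> 0 \<and> map_poly of_int g = smult (of_int c) q"
  using assms
proof (induction q)
  case 0
  show ?case by (intro exI[of _ 1] exI[of _ 0]) simp
next
  case (pCons a q)
  have "coeff q i \<in> \<rat>" for i using pCons.prems[of "Suc i"] by simp
  then obtain c g where c: "c \<noteq> 0" "map_poly of_int g = smult (of_int c) q" using pCons.IH by blast
  obtain m n where mn: "n > 0" "a = of_int m / of_int n"
    using pCons.prems[of 0] by (auto elim!: Rats_cases')
  have "map_poly of_int (pCons (c * m) (smult n g)) = smult (of_int (n * c)) (pCons a q)"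
    using mn c(2) by (simp add: map_poly_pCons map_poly_smult)
  then show ?case using c(1) mn(1) by (metis mult_eq_0_iff less_irrefl)
qed

text \<open>\<open>combine\<close> stops at the end of the shorter list, hence the
  \<open>take\<close>; the offset \<open>k\<close> serves the induction.\<close>

lemma combine_powers:
  "ring.combine complex_ring Ks (map (\<lambda>i. x ^ (k + i)) [0..<m]) = x ^ k * poly (Poly (take m Ks)) x"
proof (induction Ks arbitrary: k m)
  case Nil
  interpret field complex_ring by (rule field_from_type_algebra)
  show ?case by simp
next
  case (Cons c Ks)
  interpret field complex_ring by (rule field_from_type_algebra)
  show ?case
  proof (cases m)
    case (Suc m')
    have "map (\<lambda>i. x ^ (k + i)) [0..<m] = x ^ k # map (\<lambda>i. x ^ (Suc k + i)) [0..<m']"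
      unfolding Suc by (simp only: upt_conv_Cons[OF zero_less_Suc] map_Suc_upt[symmetric]) simp
    then show ?thesis using Cons.IH[of "Suc k" m'] by (simp add: Suc algebra_simps)
  qed simp
qed

text \<open>1, x, ..., x^d are d + 1 elements of a space of dimension d over \<rat>.\<close>

lemma number_field_int_relation:
  assumes "number_field K" "x \<in> K"
  shows "\<exists>g. g \<noteq> 0 \<and> degree g \<le> number_field_degree K \<and> ev g x = 0"
proof -
  interpret field complex_ring by (rule field_from_type_algebra)
  define d where "d = number_field_degree K"
  have K: "subfield K complex_ring" "finite_dimension \<rat> K" using assms by (auto simp: number_field_def)
  have "dimension d \<rat> K"
    using finite_dimensionE[OF subfield_Rats K(2)] by (simp add: d_def number_field_degree_def over_def)
  define Us where "Us = map (\<lambda>i. x ^ (0 + i)) [0..<Suc d]"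
  have "x ^ i \<in> K" for i by (induction i) (use assms K in \<open>auto intro: subfield_closed\<close>)
  then have "set Us \<subseteq> K" by (auto simp: Us_def)
  moreover have "length Us = Suc d" by (simp add: Us_def)
  ultimately have "dependent \<rat> Us"
    using independent_length_le_dimension[OF subfield_Rats \<open>dimension d \<rat> K\<close>] by fastforce
  then obtain Ks where Ks: "set Ks \<subseteq> \<rat>" "combine Ks Us = 0" "\<not> set (take (length Us) Ks) \<subseteq> {0}"
    using trivial_combine_imp_independent[OF subfield_Rats, where Us = Us] by auto
  define q where "q = Poly (take (Suc d) Ks)"
  have "poly q x = 0" using Ks(2) unfolding Us_def combine_powers q_def by simp
  have q: "poly.coeff q i \<in> \<rat>" for i
  proof -
    have "poly.coeff q i \<in> insert 0 (set (take (Suc d) Ks))"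
      using nth_mem[of i "take (Suc d) Ks"] by (auto simp: q_def nth_default_def)
    then show ?thesis using Ks(1) set_take_subset[of "Suc d" Ks] by auto
  qed
  have "q \<noteq> 0"
  proof
    assume "q = 0"
    obtain i where i: "i < length (take (Suc d) Ks)" "take (Suc d) Ks ! i \<noteq> 0"
      using Ks(3) \<open>length Us = Suc d\<close> unfolding subset_iff in_set_conv_nth by auto
    then have "poly.coeff q i \<noteq> 0" by (simp add: q_def nth_default_nth)
    then show False using \<open>q = 0\<close> by simp
  qed
  have "Polynomial.degree q \<le> d" by (rule degree_le) (auto simp: q_def nth_default_def)
  obtain c g where c: "c \<noteq> 0" and g: "map_poly of_int g = smult (of_int c) q"
    using clear_denominators[of q, OF q] by blast
  have "g \<noteq> 0" using g c \<open>q \<noteq> 0\<close> by auto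
  moreover have "Polynomial.degree g = Polynomial.degree q"
    using arg_cong[OF g, of Polynomial.degree] c by (simp add: degree_map_poly)
  moreover have "ev g x = 0" unfolding ev_def g using \<open>poly q x = 0\<close> by simp
  ultimately show ?thesis using \<open>Polynomial.degree q \<le> d\<close> unfolding d_def by (intro exI[of _ g]) simp
qed

text \<open>The leading coefficient of an integer relation for \<open>x\<close> makes
  \<open>x\<close> integral.\<close>

lemma integral_multiple:
  assumes K: "number_field K" and R: "ring_of_integers K = range (\<lambda>p. ev p \<alpha>)" and "x \<in> K"
  shows "\<exists>c p. c \<noteq> 0 \<and> of_int c * x = ev p \<alpha>"
proof -
  obtain g where g: "g \<noteq> 0" "ev g x = 0" using number_field_int_relation[OF K \<open>x \<in> K\<close>] by blast
  have "of_int (lead_coeff g) * x \<in> ring_of_integers K"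
    using scaled_root_algebraic_int[OF g] K \<open>x \<in> K\<close>
    by (auto simp: ring_of_integers_def number_field_def intro!: subfield_closed subfield_of_int)
  then have "of_int (lead_coeff g) * x \<in> range (\<lambda>p. ev p \<alpha>)" unfolding R .
  then show ?thesis using g(1) by (metis imageE leading_coeff_0_iff)
qed

text \<open>The embedding must send \<open>x\<close> to p(s) / c; this is independent of c and p
  because \<open>f\<close> divides every relation at \<alpha>. The target may be real or
  complex.\<close>

lemma embedding_of_root:
  fixes s :: "'b::field_char_0"
  assumes f: "minimal_int_poly f \<alpha>" and s: "ev f s = 0"
    and K: "subfield K complex_ring" "\<alpha> \<in> K"
    and mult: "\<And>x. x \<in> K \<Longrightarrow> \<exists>c p. c \<noteq> 0 \<and> of_int c * x = ev p \<alpha>"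
  shows "\<exists>\<sigma>\<in>ring_hom (complex_ring\<lparr>carrier := K\<rparr>) ring_of_type_algebra \<inter> extensional K.
    \<forall>p. \<sigma> (ev p \<alpha>) = ev p s"
proof -
  obtain c p where cp: "\<And>x. x \<in> K \<Longrightarrow> c x \<noteq> 0" "\<And>x. x \<in> K \<Longrightarrow> of_int (c x) * x = ev (p x) \<alpha>"
    using mult by metis
  define \<sigma> where "\<sigma> = (\<lambda>x\<in>K. ev (p x) s / of_int (c x))"
  have \<sigma>: "of_int k * \<sigma> x = ev q s" if "x \<in> K" "of_int k * x = ev q \<alpha>" for x k q
  proof -
    have "of_int k * ev (p x) \<alpha> = of_int (c x) * (of_int k * x)" using cp(2)[OF that(1)] by (simp add: mult_ac)
    then have "ev (smult k (p x) - smult (c x) q) \<alpha> = 0" using that(2) by simp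
    then have "ev (smult k (p x) - smult (c x) q) s = 0"
      using minimal_int_polyD(3)[OF f] ev_dvd s by blast
    then show ?thesis using cp(1)[OF that(1)] that(1) by (simp add: \<sigma>_def field_simps)
  qed
  have \<sigma>': "of_int (c x) * \<sigma> x = ev (p x) s" if "x \<in> K" for x using \<sigma> cp that by blast
  note closed = subfield_closed[OF K(1)]
  have "\<sigma> (x * y) = \<sigma> x * \<sigma> y" if "x \<in> K" "y \<in> K" for x y
  proof -
    have "of_int (c x * c y) * \<sigma> (x * y) = ev (p x * p y) s"
      using that closed cp by (intro \<sigma>) (simp_all add: mult_ac flip: cp(2))
    also have "\<dots> = of_int (c x * c y) * (\<sigma> x * \<sigma> y)" using that by (simp add: \<sigma>'[symmetric] mult_ac)
    finally show ?thesis using cp(1) that by simp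
  qed
  moreover have "\<sigma> (x + y) = \<sigma> x + \<sigma> y" if "x \<in> K" "y \<in> K" for x y
  proof -
    have "of_int (c x * c y) * \<sigma> (x + y) = ev (smult (c y) (p x) + smult (c x) (p y)) s"
      using that closed cp by (intro \<sigma>) (simp_all add: algebra_simps flip: cp(2))
    also have "\<dots> = of_int (c x * c y) * (\<sigma> x + \<sigma> y)"
      using that by (simp add: \<sigma>'[symmetric] algebra_simps)
    finally show ?thesis using cp(1) that by simp
  qed
  moreover have ev: "\<sigma> (ev q \<alpha>) = ev q s" for q
    using \<sigma>[of "ev q \<alpha>" 1 q] subfield_ev[OF K] by simp
  moreover have "\<sigma> 1 = 1" using ev[of 1] by simp
  ultimately show ?thesis
    by (intro bexI[of _ \<sigma>]) (auto intro!: ring_hom_memI simp: \<sigma>_def)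
qed

lemma embedding_ev:
  fixes \<sigma> :: "complex \<Rightarrow> 'b::comm_ring_1"
  assumes \<sigma>: "\<sigma> \<in> ring_hom (complex_ring\<lparr>carrier := K\<rparr>) ring_of_type_algebra"
    and K: "subfield K complex_ring" "\<alpha> \<in> K"
  shows "\<sigma> (ev p \<alpha>) = ev p (\<sigma> \<alpha>)"
proof -
  have add: "\<sigma> (x + y) = \<sigma> x + \<sigma> y" and mult: "\<sigma> (x * y) = \<sigma> x * \<sigma> y" if "x \<in> K" "y \<in> K" for x y
    using ring_hom_add[OF \<sigma>, of x y] ring_hom_mult[OF \<sigma>, of x y] that by simp_all
  have one: "\<sigma> 1 = 1" using ring_hom_one[OF \<sigma>] by simp
  note closed = subfield_closed[OF K(1)]
  have zero: "\<sigma> 0 = 0" using add[of 0 0] closed(4) by simp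
  have minus: "\<sigma> (- x) = - \<sigma> x" if "x \<in> K" for x
    using add[of x "- x"] zero closed(5) that by (simp add: eq_neg_iff_add_eq_0 add.commute)
  have of_nat: "\<sigma> (of_nat n) = of_nat n" for n
    using subfield_of_int[OF K(1), of "int _"] by (induction n) (simp_all add: zero one add closed(1))
  have of_int: "\<sigma> (of_int n) = of_int n" for n
    using subfield_of_int[OF K(1), of "int _"] by (cases n rule: int_cases2) (simp_all add: of_nat minus)
  show ?thesis
    by (induction p) (simp_all add: zero add mult of_int subfield_of_int subfield_ev closed K)
qed

lemma finite_bounded_int_polys: "finite {h :: int poly. degree h \<le> n \<and> (\<forall>i. \<bar>coeff h i\<bar> \<le> H)}"
proof (rule finite_subset)
  show "{h. degree h \<le> n \<and> (\<forall>i. \<bar>coeff h i\<bar> \<le> H)} \<subseteq>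
      (\<lambda>c. \<Sum>i\<le>n. monom (c i) i) ` ({..n} \<rightarrow>\<^sub>E {- H..H})"
  proof
    fix h assume h: "h \<in> {h :: int poly. degree h \<le> n \<and> (\<forall>i. \<bar>coeff h i\<bar> \<le> H)}"
    then have "h = (\<Sum>i\<le>n. monom (restrict (coeff h) {..n} i) i)"
      by (simp add: poly_as_sum_of_monoms')
    moreover have "restrict (coeff h) {..n} \<in> {..n} \<rightarrow>\<^sub>E {- H..H}" using h by (auto simp: abs_le_iff minus_le_iff)
    ultimately show "h \<in> (\<lambda>c. \<Sum>i\<le>n. monom (c i) i) ` ({..n} \<rightarrow>\<^sub>E {- H..H})" by blast
  qed
qed (auto intro: finite_PiE)

subsection \<open>Fields with a universal form\<close>

text \<open>The bound of \<open>bounded_nonconstant\<close> on the sum of squared conjugates, at the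
  \<open>J\<close> of \<open>codifferent_gap\<close>.\<close>

definition house_bound :: "nat \<Rightarrow> nat \<Rightarrow> nat"
  where "house_bound r n = n\<^sup>2 * 2 ^ n * ((8 * n + 1) ^ (n * r) + 1)\<^sup>2"

text \<open>The \<open>H\<close> of \<open>bounded_relation\<close> for this bound.\<close>

definition coeff_bound :: "nat \<Rightarrow> nat \<Rightarrow> nat"
  where "coeff_bound r n = (3 * ((n + 1) * house_bound r n ^ n)) ^ n + 1"

text \<open>\<open>n\<close> stands for the degree of the minimal polynomial of \<alpha>, which
  enters only through \<open>n \<le> d\<close>.\<close>

definition small_relations :: "nat \<Rightarrow> nat \<Rightarrow> int poly set"
  where "small_relations d r =
    (\<Union>n\<le>d. {h. h \<noteq> 0 \<and> degree h \<le> n \<and> (\<forall>i. \<bar>coeff h i\<bar> \<le> int (coeff_bound r n))})"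

lemma finite_small_relation_roots: "finite {t :: complex. \<exists>h\<in>small_relations d r. ev h t = 0}"
proof -
  have "finite (small_relations d r)"
    unfolding small_relations_def
    by (intro finite_UN_I finite_subset[OF _ finite_bounded_int_polys]) auto
  moreover have "finite {t :: complex. ev h t = 0}" if "h \<in> small_relations d r" for h
  proof -
    have "h \<noteq> 0" using that by (auto simp: small_relations_def)
    then have "map_poly of_int h \<noteq> (0 :: complex poly)" by (subst map_poly_eq_0_iff) auto
    then show ?thesis unfolding ev_def by (rule poly_roots_finite)
  qed
  ultimately have "finite (\<Union>h\<in>small_relations d r. {t :: complex. ev h t = 0})" by blast
  moreover have "{t :: complex. \<exists>h\<in>small_relations d r. ev h t = 0} =
    (\<Union>h\<in>small_relations d r. {t. ev h t = 0})" by blast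
  ultimately show ?thesis by simp
qed

lemma generator_of_small_height:
  fixes K :: "complex set" and d r :: nat
  assumes nf: "number_field K" and d: "number_field_degree K = d" and real: "totally_real K"
    and mono: "monogenic K" and units: "units_of_every_signature K"
    and form: "quadratic_form K r a" and univ: "universal_form K r a"
    and "\<not> K \<subseteq> \<rat>"
  shows "\<exists>t\<in>K. t \<notin> \<rat> \<and> (\<exists>h\<in>small_relations d r. ev h t = 0)"
proof -
  have K: "subfield K complex_ring" using nf by (simp add: number_field_def)
  obtain \<alpha> where \<alpha>: "\<alpha> \<in> ring_of_integers K" and R: "ring_of_integers K = range (\<lambda>p. ev p \<alpha>)"
    using mono unfolding monogenic_def ev_def by blast
  have "\<alpha> \<in> K" "algebraic_int \<alpha>" using \<alpha> by (auto simp: ring_of_integers_def)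
  obtain f where f: "minimal_int_poly f \<alpha>" using minimal_int_poly_exists[OF \<open>algebraic_int \<alpha>\<close>] by blast
  note fD = minimal_int_polyD[OF f]
  note mult = integral_multiple[OF nf R]
  \<comment> \<open>Every complex root of \<open>f\<close> is the image of \<alpha> under an
    embedding, hence real.\<close>
  have f_real: "s \<in> \<real>" if s: "ev f s = 0" for s :: complex
  proof -
    obtain \<sigma> where \<sigma>: "\<sigma> \<in> complex_embeddings K" "\<And>p. \<sigma> (ev p \<alpha>) = ev p s"
      using embedding_of_root[OF f s K \<open>\<alpha> \<in> K\<close> mult] unfolding complex_embeddings_def by blast
    have "\<sigma> \<alpha> = s" using \<sigma>(2)[of "monom 1 1"] by simp
    then show ?thesis using real \<sigma>(1) \<open>\<alpha> \<in> K\<close> unfolding totally_real_def by blast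
  qed
  define A where "A = {a :: real. ev f a = 0}"
  note split = minimal_int_poly_split_real[OF f f_real, folded A_def]
  \<comment> \<open>Agreement at \<alpha> amounts to agreement on \<open>A\<close>, and real
    embeddings correspond to points of \<open>A\<close>; this carries the hypotheses on
    \<open>K\<close> over to the order.\<close>
  have conj: "ev p x = ev q x" if "ev p \<alpha> = ev q \<alpha>" "x \<in> A" for p q x
    using ev_dvd[OF fD(3)[of "p - q"], of x] that by (simp add: A_def)
  have conj': "ev p \<alpha> = ev q \<alpha>" if "\<And>x. x \<in> A \<Longrightarrow> ev p x = ev q x" for p q
    using split(4) that by fastforce
  have emb: "\<sigma> \<alpha> \<in> A" "\<sigma> (ev p \<alpha>) = ev p (\<sigma> \<alpha>)" if "\<sigma> \<in> real_embeddings K" for \<sigma> p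
  proof -
    have ev: "\<sigma> (ev p \<alpha>) = ev p (\<sigma> \<alpha>)" for p
      using that embedding_ev[OF _ K \<open>\<alpha> \<in> K\<close>] unfolding real_embeddings_def by blast
    show "\<sigma> (ev p \<alpha>) = ev p (\<sigma> \<alpha>)" by (rule ev)
    show "\<sigma> \<alpha> \<in> A" using ev[of f] ev[of 0] fD(2) by (simp add: A_def)
  qed
  have emb_ex: "\<exists>\<sigma>\<in>real_embeddings K. \<sigma> \<alpha> = x \<and> (\<forall>p. \<sigma> (ev p \<alpha>) = ev p x)" if "x \<in> A" for x
  proof -
    have "ev f x = 0" using that by (simp add: A_def)
    from embedding_of_root[OF f this K \<open>\<alpha> \<in> K\<close> mult]
    obtain \<sigma> where \<sigma>: "\<sigma> \<in> real_embeddings K" "\<And>p. \<sigma> (ev p \<alpha>) = ev p x"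
      unfolding real_embeddings_def by blast
    have "\<sigma> \<alpha> = x" using \<sigma>(2)[of "monom 1 1"] by simp
    then show ?thesis using \<sigma> by blast
  qed
  have pos: "totally_positive K (ev p \<alpha>) \<longleftrightarrow> (\<forall>x\<in>A. ev p x > 0)" for p
    unfolding totally_positive_def using emb emb_ex by metis
  have pderiv: "ev (pderiv f) x \<noteq> 0" if "x \<in> A" for x
    using minimal_int_poly_pderiv[OF minimal_int_poly_conjugate[OF f]] that by (simp add: A_def)

  \<comment> \<open>The signature of f'(\<alpha>), to be matched by a unit.\<close>
  define s where "s \<sigma> = sgn (ev (pderiv f) (\<sigma> \<alpha>))" for \<sigma> :: "complex \<Rightarrow> real"
  have "\<forall>\<sigma>\<in>real_embeddings K. s \<sigma> \<in> {1, - 1}"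
    using pderiv emb(1) by (auto simp: sgn_if s_def)
  then have "\<exists>U\<in>Units (complex_ring\<lparr>carrier := ring_of_integers K\<rparr>).
      \<forall>\<sigma>\<in>real_embeddings K. sgn (\<sigma> U) = s \<sigma>"
    using units unfolding units_of_every_signature_def by blast
  then obtain U where U: "U \<in> Units (complex_ring\<lparr>carrier := ring_of_integers K\<rparr>)"
    "\<And>\<sigma>. \<sigma> \<in> real_embeddings K \<Longrightarrow> sgn (\<sigma> U) = sgn (ev (pderiv f) (\<sigma> \<alpha>))"
    unfolding s_def by blast
  then obtain U' where "U \<in> ring_of_integers K" "U' \<in> ring_of_integers K" "U * U' = 1"
    by (auto simp: Units_def)
  then obtain u u' where u: "U = ev u \<alpha>" "ev u \<alpha> * ev u' \<alpha> = 1" unfolding R by blast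

  \<comment> \<open>A single root would make \<alpha>, and with it all of \<open>K\<close>,
    rational.\<close>
  have "card A \<ge> 2"
  proof (rule ccontr)
    assume "\<not> card A \<ge> 2"
    moreover have "card A \<noteq> 0" using split(1,4) by auto
    ultimately have "degree f = 1" using split(2) by simp
    then obtain c k where "f = [:c, k:]" "k \<noteq> 0" by (metis degree1_coeffs)
    then have "of_int c + \<alpha> = 0" using fD(1,2) by simp
    then have "\<alpha> = of_int (- c)" by (simp add: eq_neg_iff_add_eq_0 add.commute)
    then have "\<alpha> \<in> \<rat>" by (metis Rats_of_int)
    then have rat: "ev p \<alpha> \<in> \<rat>" for p by (intro subfield_ev subfield_Rats)
    have "x \<in> \<rat>" if x: "x \<in> K" for x
    proof -
      obtain c p where "c \<noteq> 0" "of_int c * x = ev p \<alpha>" using mult[OF x] by blast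
      then have "x = ev p \<alpha> / of_int c" by (simp add: field_simps)
      then show ?thesis using rat by simp
    qed
    then show False using \<open>\<not> K \<subseteq> \<rat>\<close> by blast
  qed
  interpret signed_order f u u' A
  proof
    show "ev u x * ev u' x = 1" if "x \<in> A" for x
      using conj[of "u * u'" 1 x] u(2) that by simp
    show "ev u x / ev (pderiv f) x > 0" if x: "x \<in> A" for x
    proof -
      obtain \<sigma> where \<sigma>: "\<sigma> \<in> real_embeddings K" "\<sigma> \<alpha> = x" "\<And>p. \<sigma> (ev p \<alpha>) = ev p x"
        using emb_ex[OF x] by blast
      have "sgn (ev u x) = sgn (ev (pderiv f) x)" using U(2)[OF \<sigma>(1)] \<sigma>(2,3) u(1) by simp
      then show ?thesis using pderiv[OF that]
        by (auto simp: sgn_if zero_less_divide_iff split: if_splits)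
    qed
  qed (use fD(1) split \<open>card A \<ge> 2\<close> in auto)

  have "\<exists>p. i \<le> j \<and> j < r \<longrightarrow> a i j = ev p \<alpha>" for i j
    using form R unfolding quadratic_form_def by blast
  then obtain Q where Q: "\<And>i j. i \<le> j \<Longrightarrow> j < r \<Longrightarrow> a i j = ev (Q i j) \<alpha>" by metis
  define F where "F v = (\<Sum>i<r. \<Sum>j=i..<r. Q i j * v i * v j)" for v
  have F: "eval_form r a v = ev (F v') \<alpha>" if "\<And>i. i < r \<Longrightarrow> v i = ev (v' i) \<alpha>" for v v'
    unfolding eval_form_def F_def by (simp add: Q that)
  define J where "J = (8 * card A + 1) ^ (card A * r) + 1"
  have gap: "\<exists>x\<in>A. \<delta> x * \<bar>ev z x\<bar> \<ge> 1 / real J" if "x0 \<in> A" "ev z x0 \<noteq> 0" for z x0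
    unfolding J_def
  proof (rule codifferent_gap[where Q = Q and r = r, folded F_def])
    show "ev (F v) x > 0" if "i < r" "b \<in> A" "ev (v i) b \<noteq> 0" "x \<in> A" for v i b x
    proof -
      define v' where "v' = (\<lambda>i. ev (v i) \<alpha>)"
      \<comment> \<open>An entry that is nonzero at one conjugate is nonzero at \<alpha>.\<close>
      have "v' i \<noteq> 0" using conj[of "v i" 0 b] that by (auto simp: v'_def)
      moreover have "v' \<in> integral_vectors K r" by (simp add: integral_vectors_def R v'_def)
      ultimately have "totally_positive K (eval_form r a v')"
        using univ \<open>i < r\<close> unfolding universal_form_def totally_positive_definite_def by blast
      then show ?thesis using F[of v' v] pos \<open>x \<in> A\<close> by (simp add: v'_def)
    qed
    show "\<exists>v. \<forall>x\<in>A. ev (F v) x = ev p x" if "\<And>x. x \<in> A \<Longrightarrow> ev p x > 0" for p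
    proof -
      have "totally_positive K (ev p \<alpha>)" using that pos by blast
      moreover have "ev p \<alpha> \<in> ring_of_integers K" by (simp add: R)
      ultimately obtain v where v: "v \<in> integral_vectors K r" "eval_form r a v = ev p \<alpha>"
        using univ unfolding universal_form_def by blast
      have "\<exists>q. i < r \<longrightarrow> v i = ev q \<alpha>" for i using v(1) R unfolding integral_vectors_def by blast
      then obtain v' where "\<And>i. i < r \<Longrightarrow> v i = ev (v' i) \<alpha>" by metis
      then have "ev (F v') \<alpha> = ev p \<alpha>" using F v(2) by metis
      then show ?thesis using conj by blast
    qed
  qed (use that in auto)
  have "J > 0" by (simp add: J_def)
  then have "real J > 0" by simp
  have "\<exists>\<theta>. (\<Sum>x\<in>A. (ev \<theta> x)\<^sup>2) \<le> (real (card A))\<^sup>2 * 2 ^ card A * (real J)\<^sup>2 \<and>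
      (\<exists>x\<in>A. \<exists>y\<in>A. ev \<theta> x \<noteq> ev \<theta> y)"
    by (rule bounded_nonconstant[OF \<open>real J > 0\<close>]) (rule gap)
  then obtain \<theta> where \<theta>: "(\<Sum>x\<in>A. (ev \<theta> x)\<^sup>2) \<le> (real (card A))\<^sup>2 * 2 ^ card A * (real J)\<^sup>2"
    and nonconst: "\<exists>x\<in>A. \<exists>y\<in>A. ev \<theta> x \<noteq> ev \<theta> y"
    by blast
  define b where "b = house_bound r (card A)"
  have "b \<ge> 1" using card_A by (simp add: b_def house_bound_def)
  have sum_b: "(\<Sum>x\<in>A. (ev \<theta> x)\<^sup>2) \<le> real b" using \<theta> by (simp add: b_def house_bound_def J_def)
  have \<theta>_b: "\<bar>ev \<theta> x\<bar> \<le> real b" if "x \<in> A" for x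
  proof -
    have "(ev \<theta> x)\<^sup>2 \<le> (\<Sum>x\<in>A. (ev \<theta> x)\<^sup>2)" using that finite_A by (intro member_le_sum) auto
    also note sum_b
    \<comment> \<open>This avoids a square root and keeps the bound a natural number.\<close>
    also have "real b \<le> (real b)\<^sup>2" using \<open>b \<ge> 1\<close> by (simp add: power2_eq_square)
    finally show ?thesis by (simp add: abs_le_square_iff[symmetric])
  qed
  obtain h where h: "h \<noteq> 0" "degree h \<le> card A" "\<And>i. \<bar>coeff h i\<bar> \<le> int (coeff_bound r (card A))"
    "\<And>x. x \<in> A \<Longrightarrow> ev h (ev \<theta> x) = 0"
    using bounded_relation[OF \<open>b \<ge> 1\<close> \<theta>_b] unfolding coeff_bound_def b_def by blast
  obtain g where g: "g \<noteq> 0" "degree g \<le> d" "ev g \<alpha> = 0"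
    using number_field_int_relation[OF nf \<open>\<alpha> \<in> K\<close>] d by blast
  \<comment> \<open>\<open>f\<close> divides an integer relation for \<alpha> of degree at most
    \<open>d\<close>.\<close>
  have "card A \<le> d" using dvd_imp_degree_le[OF fD(3)[OF g(3)] g(1)] g(2) degree_f by simp
  then have "h \<in> small_relations d r" using h by (auto simp: small_relations_def)
  moreover have "ev h (ev \<theta> \<alpha>) = 0" using conj'[of "pcompose h \<theta>" 0] h(4) by simp
  moreover have "ev \<theta> \<alpha> \<in> K" by (rule subfield_ev[OF K \<open>\<alpha> \<in> K\<close>])
  moreover have "ev \<theta> \<alpha> \<notin> \<rat>"
  proof
    \<comment> \<open>A rational value would be shared by all conjugates.\<close>
    assume "ev \<theta> \<alpha> \<in> \<rat>"
    then obtain m k where "k > 0" "ev \<theta> \<alpha> = of_int m / of_int k" by (elim Rats_cases')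
    then have eq: "ev (smult k \<theta>) \<alpha> = ev (of_int m) \<alpha>" by simp
    have "ev \<theta> x = of_int m / of_int k" if "x \<in> A" for x
      using conj[OF eq that] \<open>k > 0\<close> by (simp add: field_simps)
    then show False using nonconst by simp
  qed
  ultimately show ?thesis by blast
qed

theorem theorem4:
  fixes d r :: nat
  shows "finite {K. number_field K \<and> number_field_degree K = d \<and> totally_real K \<and>
    primitive_field K \<and> condition_A K \<and> (\<exists>a. quadratic_form K r a \<and> universal_form K r a)}"
    (is "finite ?\<K>")
proof -
  interpret field complex_ring by (rule field_from_type_algebra)
  define T where "T = {t :: complex. \<exists>h\<in>small_relations d r. ev h t = 0}"
  have "?\<K> \<subseteq> insert \<rat> (generate_field complex_ring ` insert {} ((\<lambda>t. {t}) ` T))"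
  proof
    fix K assume K: "K \<in> ?\<K>"
    have sub: "subfield K complex_ring" using K by (simp add: number_field_def)
    have prim: "generate_field complex_ring H = \<rat> \<or> generate_field complex_ring H = K" if "H \<subseteq> K" for H
    proof -
      have "subfield (generate_field complex_ring H) complex_ring" by (rule generate_field_is_subfield) simp
      moreover have "generate_field complex_ring H \<subseteq> K"
        using generate_field_min_subfield1[OF _ sub that] by simp
      ultimately show ?thesis using K by (simp add: primitive_field_def)
    qed
    show "K \<in> insert \<rat> (generate_field complex_ring ` insert {} ((\<lambda>t. {t}) ` T))"
    proof (cases "K \<subseteq> \<rat>")
      case True
      \<comment> \<open>The prime field, generated by the empty set, is \<rat> or \<open>K\<close>
        by primitivity; both are in the finite set.\<close>
      have "generate_field complex_ring {} \<subseteq> K"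
        using generate_field_min_subfield1[OF _ sub, of "{}"] by simp
      then show ?thesis using prim[of "{}"] True by blast
    next
      case False
      obtain a where a: "quadratic_form K r a" "universal_form K r a" using K by blast
      obtain t where t: "t \<in> K" "t \<notin> \<rat>" "t \<in> T"
        using generator_of_small_height[OF _ _ _ _ _ a False] K unfolding T_def condition_A_def by blast
      have "t \<in> generate_field complex_ring {t}" by (rule generate_field.incl) simp
      then have "generate_field complex_ring {t} = K" using prim[of "{t}"] t by auto
      then show ?thesis using t(3) by blast
    qed
  qed
  moreover have "finite T" unfolding T_def by (rule finite_small_relation_roots)
  ultimately show ?thesis by (meson finite_imageI finite_insert finite_subset)
qed

end
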